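(* Let $\mathcal{A}\subset\mathbb{R}^d$ be compact, $\mathbb{P}$ a probability measure with support $\mathcal{A}$, and $\mathcal{K}$ a continuous, square integrable, positive definite kernel on $\mathcal{A}$ with RKHS $\mathcal{H}$ and feature map $\Phi$, satisfying $\sup_{a\in\mathcal{A}}\mathcal{K}(a,a)\le\mathcal{G}^2$. Let $\mu_1\ge\mu_2\ge\cdots$ be its Mercer eigenvalues under $\mathbb{P}$ with eigenfunctions $\phi_j$ satisfying $\sup_j\sup_{x\in\mathcal{A}}|\phi_j(x)|\le\mathcal{B}<\infty$. Let $\epsilon>0$ and let $m$ be such that $\sum_{j=m+1}^\infty\mu_j\le\frac{\epsilon}{4\mathcal{B}^2}$. Let $\delta_m=\frac12(\mu_m-\mu_{m+1})$, $\alpha>0$, $B_m=\frac{2\mathcal{G}^2}{\delta_m}\left(1+\sqrt{\alpha/2}\right)$ and $p\ge\frac{4B_m^2\mathcal{G}^2}{(\min(\sqrt\epsilon,\delta_m))^2}$. Then with probability at least $1-e^{-\alpha}$ over $x_1,\dots,x_p\sim\mathbb{P}$ i.i.d.: (1) $\sup_{x,y\in\mathcal{A}}|\mathcal{K}(x,y)-\hat{\mathcal{K}}_m(x,y)|\le\epsilon$; (2) if $\mu_1^{(p)}\ge\cdots\ge\mu_m^{(p)}$ denote the Mercer eigenvalues of $\hat{\mathcal{K}}_m$ under $\mathbb{P}$ and $\mu_1\ge\cdots\ge\mu_m$ those of $\hat{\mathcal{K}}_m^o$ (which coincide with the top $m$ Mercer eigenvalues of $\mathcal{K}$), then $\sup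_{i=1,\dots,m}|\mu_i^{(p)}-\mu_i|\le\epsilon/4$.
   Context: Mercer eigenvalues/eigenfunctions of a kernel under $\mathbb{P}$: eigenvalues and $L_2(\mathcal{A};\mathbb{P})$-orthonormal eigenfunctions of the operator $(\mathcal{T}f)(\cdot)=\int_{\mathcal{A}}\mathcal{K}(\cdot,x)f(x)\,d\mathbb{P}(x)$, so that $\mathcal{K}(u,v)=\sum_j\mu_j\phi_j(u)\phi_j(v)$. Deterministic truncated kernel: $\hat{\mathcal{K}}_m^o(x,y)=\sum_{j=1}^m\mu_j\phi_j(x)\phi_j(y)$, i.e. the kernel of the feature map $P_{S_m}\Phi(x)$ with $S_m$ the span of the top $m$ eigenvectors of $\mathbb{E}_{x\sim\mathbb{P}}[\Phi(x)\Phi(x)^\top]$. Stochastic proxy kernel: given samples $x_1,\dots,x_p$ i.i.d. from $\mathbb{P}$, let $\hat S_m$ be the span of the top $m$ eigenvectors of the sample covariance $\hat\Sigma=\frac1p\sum_{i=1}^p\Phi(x_i)\Phi(x_i)^\top$, $\Phi_m(x)=P_{\hat S_m}(\Phi(x))$ the orthogonal projection onto $\hat S_m$, and $\hat{\mathcal{K}}_m(x,y)=\langle\Phi_m(x),\Phi_m(y)\rangle_{\mathcal{H}}$. *)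

theory Defs
  imports "HOL-Probability.Probability"
begin

definition measure_support :: "'a::topological_space measure \<Rightarrow> 'a set" where
  "measure_support M = {x. \<forall>U. open U \<longrightarrow> x \<in> U \<longrightarrow> emeasure M U > 0}"

definition pos_def_kernel :: "'a set \<Rightarrow> ('a \<Rightarrow> 'a \<Rightarrow> real) \<Rightarrow> bool" where
  "pos_def_kernel A K \<longleftrightarrow>
     (\<forall>x\<in>A. \<forall>y\<in>A. K x y = K y x) \<and>
     (\<forall>n (x :: nat \<Rightarrow> 'a) (c :: nat \<Rightarrow> real). (\<forall>i<n. x i \<in> A) \<longrightarrow>
        (\<Sum>i<n. \<Sum>j<n. c i * c j * K (x i) (x j)) \<ge> 0)"

text \<open>Mercer eigen-system of K under P (0-based indexing: nu 0 is the largest eigenvalue).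
  Eigenvalues are non-negative and non-increasing; the eigenfunctions belonging to positive
  eigenvalues are L2(P)-orthonormal eigenfunctions of the integral operator; and the Mercer
  expansion converges uniformly on A x A. Entries with eigenvalue 0 are padding (finite rank).\<close>
definition mercer_system ::
  "'a::topological_space measure \<Rightarrow> 'a set \<Rightarrow> ('a \<Rightarrow> 'a \<Rightarrow> real) \<Rightarrow> (nat \<Rightarrow> real)
     \<Rightarrow> (nat \<Rightarrow> 'a \<Rightarrow> real) \<Rightarrow> bool" where
  "mercer_system P A K \<nu> \<psi> \<longleftrightarrow>
     (\<forall>j. 0 \<le> \<nu> j) \<and> (\<forall>i j. i \<le> j \<longrightarrow> \<nu> j \<le> \<nu> i) \<and>
     (\<forall>j. \<psi> j \<in> borel_measurable P) \<and>
     (\<forall>j. 0 < \<nu> j \<longrightarrow> integrable P (\<lambda>x. (\<psi> j x)\<^sup>2)) \<and>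
     (\<forall>i j. 0 < \<nu> i \<longrightarrow> 0 < \<nu> j \<longrightarrow>
        (LINT x|P. \<psi> i x * \<psi> j x) = (if i = j then 1 else 0)) \<and>
     (\<forall>j. 0 < \<nu> j \<longrightarrow> (\<forall>x\<in>A. integrable P (\<lambda>y. K x y * \<psi> j y) \<and>
        (LINT y|P. K x y * \<psi> j y) = \<nu> j * \<psi> j x)) \<and>
     uniform_limit (A \<times> A) (\<lambda>n (u, v). \<Sum>j<n. \<nu> j * \<psi> j u * \<psi> j v)
        (\<lambda>(u, v). K u v) sequentially"

definition top_eigenspace :: "('h::real_inner \<Rightarrow> 'h) \<Rightarrow> nat \<Rightarrow> 'h set \<Rightarrow> bool" where
  "top_eigenspace C m S \<longleftrightarrow>
     (\<exists>(e :: nat \<Rightarrow> 'h) (lam :: nat \<Rightarrow> real).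
        (\<forall>i<m. \<forall>j<m. e i \<bullet> e j = (if i = j then 1 else 0)) \<and>
        (\<forall>i<m. C (e i) = lam i *\<^sub>R e i) \<and>
        (\<forall>i j. i \<le> j \<longrightarrow> j < m \<longrightarrow> lam j \<le> lam i) \<and>
        (\<forall>v c. v \<noteq> 0 \<longrightarrow> (\<forall>i<m. v \<bullet> e i = 0) \<longrightarrow> C v = c *\<^sub>R v \<longrightarrow> c \<le> lam (m - 1)) \<and>
        S = span (e ` {..<m}))"

definition orth_proj :: "'h::real_inner set \<Rightarrow> 'h \<Rightarrow> 'h" where
  "orth_proj S v = (THE w. w \<in> S \<and> (\<forall>u\<in>S. (v - w) \<bullet> u = 0))"

definition sample_cov :: "('a \<Rightarrow> 'h::real_inner) \<Rightarrow> nat \<Rightarrow> (nat \<Rightarrow> 'a) \<Rightarrow> 'h \<Rightarrow> 'h" where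
  "sample_cov \<Phi> p xs v = (1 / real p) *\<^sub>R (\<Sum>i<p. (\<Phi> (xs i) \<bullet> v) *\<^sub>R \<Phi> (xs i))"

definition proxy_kernel :: "('a \<Rightarrow> 'h::real_inner) \<Rightarrow> 'h set \<Rightarrow> 'a \<Rightarrow> 'a \<Rightarrow> real" where
  "proxy_kernel \<Phi> S x y = orth_proj S (\<Phi> x) \<bullet> orth_proj S (\<Phi> y)"

end

theory Submission
  imports Defs
begin

text \<open>The Mercer eigenfunctions correspond, via Riesz representation, to orthonormal eigenvectors
  \<open>e\<^sub>j\<close> of the population covariance \<open>\<Sigma>\<close>. McDiarmid's inequality bounds
  the Hilbert-Schmidt norm of \<open>\<Sigma> - \<Sigma>'\<close>, where \<open>\<Sigma>'\<close> is the sample covariance, by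
  \<open>t = (2 G\<^sup>2 / sqrt p) (1 + sqrt (\<alpha> / 2))\<close> with probability at least \<open>1 - exp (- \<alpha>)\<close>.
  Write \<open>Q\<close> and \<open>Q'\<close> for the projections onto the top \<open>m\<close> eigenspaces of \<open>\<Sigma>\<close> and \<open>\<Sigma>'\<close>, and
  \<open>\<tau>\<close> for the sum of \<open>\<parallel>e\<^sub>j - Q' e\<^sub>j\<parallel>\<^sup>2\<close> over \<open>j < m\<close>. Since \<open>Q'\<close> maximizes the trace against \<open>\<Sigma>'\<close>,
  pairing \<open>\<Sigma> - \<Sigma>'\<close> with \<open>Q - Q'\<close> gives \<open>2 \<delta> \<tau> \<le> t sqrt (2 \<tau>)\<close>, so that \<open>G\<^sup>2 \<tau> \<le> \<epsilon> / 8\<close>. Then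
  \<open>\<parallel>\<Phi> x - Q' \<Phi> x\<parallel> \<le> G sqrt \<tau> + sqrt (\<epsilon> / 4) \<le> sqrt \<epsilon>\<close>, which is the first claim; and by
  the min-max principle the eigenvalues of \<open>Q' \<Sigma> Q'\<close> lie below those of \<open>\<Sigma>\<close>, by at most
  \<open>2 G\<^sup>2 \<tau> \<le> \<epsilon> / 4\<close>.\<close>

section \<open>Inner product spaces\<close>

text \<open>The gap is known for \<Sigma> only; nothing is known about the spectrum of \<Sigma>'.
  Bounds that separate the two spectra do not apply directly. The variational argument uses the
  population gap alone and treats every top eigenspace of \<Sigma>' at once, ties included. The
  sample size gives a bound on G^2 \<tau>, while the distance of the two projections is of order
  sqrt \<tau>. A Weyl type bound would put this square root into the eigenvalue error, so the
  eigenvalue loss has to be shown quadratic in the angle. The population covariance is never formed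
  as an operator. It is used in the coordinates of the eigenvectors: finite blocks of \<Sigma> -
  \<Sigma>' are random matrices with bounds independent of their size, and limits are taken along
  the blocks. The good event is a countable intersection over block sizes, hence measurable, which
  is not evident for an event quantified over all eigenspaces. Parseval's identity for \<Phi> x,
  read off the Mercer expansion on the diagonal, ensures that the blocks exhaust everything that
  matters.\<close>

text \<open>Solving the row \<open>r\<close> for a pivot unknown \<open>q\<close> leaves one
  equation and one unknown fewer. This is the dimension count behind the min-max comparisons:
  \<open>i\<close> orthogonality conditions on the span of \<open>i + 1\<close>
  eigenvectors.\<close>

lemma homogeneous_system_nontrivial_solution:
  fixes M :: "'j \<Rightarrow> 'i \<Rightarrow> 'k::field"
  assumes "finite J" "finite I" "card J < card I"
  shows "\<exists>c. (\<exists>k\<in>I. c k \<noteq> 0) \<and> (\<forall>j\<in>J. (\<Sum>k\<in>I. c k * M j k) = 0)"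
  using assms
proof (induction J arbitrary: I M rule: finite_induct)
  case empty
  then show ?case
    by (intro exI[of _ "\<lambda>_. 1"]) (auto simp: card_gt_0_iff)
next
  case (insert r J)
  show ?case
  proof (cases "\<forall>k\<in>I. M r k = 0")
    case True
    obtain c where "\<exists>k\<in>I. c k \<noteq> 0" "\<forall>j\<in>J. (\<Sum>k\<in>I. c k * M j k) = 0"
      using insert.IH[of I M] insert.prems insert.hyps by auto
    with True show ?thesis by (intro exI[of _ c]) auto
  next
    case False
    then obtain q where q: "q \<in> I" "M r q \<noteq> 0" by blast
    have card: "card J < card (I - {q})"
      using insert q by simp
    obtain c where c: "\<exists>k\<in>I - {q}. c k \<noteq> 0"
        "\<And>j. j \<in> J \<Longrightarrow> (\<Sum>k\<in>I - {q}. c k * (M j k - M j q * M r k / M r q)) = 0"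
      using insert.IH[of "I - {q}" "\<lambda>j k. M j k - M j q * M r k / M r q"] card insert.prems by auto
    define s where "s = (\<Sum>k\<in>I - {q}. c k * M r k)"
    \<comment> \<open>The value at the pivot is forced by the row \<open>r\<close>; the other rows
      then vanish by the reduced system.\<close>
    define c' where "c' = c(q := - s / M r q)"
    have split: "(\<Sum>k\<in>I. c' k * M j k) = - s / M r q * M j q + (\<Sum>k\<in>I - {q}. c k * M j k)" for j
      using q insert.prems by (subst sum.remove[of _ q]) (auto simp: c'_def intro!: sum.cong)
    have "(\<Sum>k\<in>I. c' k * M j k) = 0" if "j \<in> J" for j
    proof -
      have "(\<Sum>k\<in>I - {q}. c k * (M j k - M j q * M r k / M r q))
          = (\<Sum>k\<in>I - {q}. c k * M j k) - s / M r q * M j q"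
        by (simp add: s_def sum_divide_distrib sum_distrib_left sum_distrib_right
            sum_subtractf[symmetric] algebra_simps)
      with c(2)[OF that] show ?thesis by (simp add: split)
    qed
    moreover have "(\<Sum>k\<in>I. c' k * M r k) = 0"
      using q by (simp add: split s_def)
    moreover have "\<exists>k\<in>I. c' k \<noteq> 0"
      using c(1) by (auto simp: c'_def)
    ultimately show ?thesis by (intro exI[of _ c']) auto
  qed
qed

lemma norm_sum_scaleR_orthogonal:
  fixes e :: "'i \<Rightarrow> 'h::real_inner"
  assumes "finite I" and "\<And>i j. i \<in> I \<Longrightarrow> j \<in> I \<Longrightarrow> i \<noteq> j \<Longrightarrow> e i \<bullet> e j = 0"
  shows "(norm (\<Sum>i\<in>I. c i *\<^sub>R e i))\<^sup>2 = (\<Sum>i\<in>I. (c i)\<^sup>2 * (norm (e i))\<^sup>2)"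
proof -
  have "(\<Sum>i\<in>I. c i *\<^sub>R e i) \<bullet> (\<Sum>i\<in>I. c i *\<^sub>R e i)
      = (\<Sum>i\<in>I. \<Sum>j\<in>I. c i * c j * (e i \<bullet> e j))"
    by (simp add: inner_sum_left inner_sum_right sum_distrib_left algebra_simps)
      (simp add: inner_commute)
  also have "\<dots> = (\<Sum>i\<in>I. \<Sum>j\<in>I. if j = i then c i * c i * (e i \<bullet> e i) else 0)"
    using assms by (intro sum.cong refl) auto
  also have "\<dots> = (\<Sum>i\<in>I. (c i)\<^sup>2 * (norm (e i))\<^sup>2)"
    using assms by (simp add: sum.delta' power2_eq_square[of "c _"] dot_square_norm)
  finally show ?thesis by (simp add: power2_norm_eq_inner)
qed

lemma inner_sum_scaleR_orthonormal:
  fixes e :: "'i \<Rightarrow> 'h::real_inner"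
  assumes "finite I" "j \<in> I" and "\<And>i. i \<in> I \<Longrightarrow> e i \<bullet> e j = (if i = j then 1 else 0)"
  shows "(\<Sum>i\<in>I. c i *\<^sub>R e i) \<bullet> e j = c j"
proof -
  have "(\<Sum>i\<in>I. c i *\<^sub>R e i) \<bullet> e j = (\<Sum>i\<in>I. if i = j then c i else 0)"
    unfolding inner_sum_left using assms by (intro sum.cong) auto
  then show ?thesis using assms by simp
qed

text \<open>Norms below 1 are allowed because the eigenvector families contain zero vectors as
  padding.\<close>

lemma bessel:
  fixes e :: "'i \<Rightarrow> 'h::real_inner"
  assumes "finite I" and orth: "\<And>i j. i \<in> I \<Longrightarrow> j \<in> I \<Longrightarrow> i \<noteq> j \<Longrightarrow> e i \<bullet> e j = 0"
    and norm: "\<And>i. i \<in> I \<Longrightarrow> norm (e i) \<le> 1"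
  shows "(\<Sum>i\<in>I. (h \<bullet> e i)\<^sup>2) \<le> (norm h)\<^sup>2"
proof -
  define w where "w = (\<Sum>i\<in>I. (h \<bullet> e i) *\<^sub>R e i)"
  have "h \<bullet> w = (\<Sum>i\<in>I. (h \<bullet> e i)\<^sup>2)"
    by (simp add: w_def inner_sum_right power2_eq_square)
  moreover have "(norm w)\<^sup>2 \<le> (\<Sum>i\<in>I. (h \<bullet> e i)\<^sup>2)"
  proof -
    have "(norm w)\<^sup>2 = (\<Sum>i\<in>I. (h \<bullet> e i)\<^sup>2 * (norm (e i))\<^sup>2)"
      unfolding w_def using assms(1) orth by (rule norm_sum_scaleR_orthogonal)
    also have "\<dots> \<le> (\<Sum>i\<in>I. (h \<bullet> e i)\<^sup>2)"
      using norm by (intro sum_mono mult_left_le) (auto simp: power_le_one)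
    finally show ?thesis .
  qed
  moreover have "0 \<le> (norm (h - w))\<^sup>2" by simp
  ultimately show ?thesis
    by (simp add: power2_norm_eq_inner inner_diff inner_commute)
qed

text \<open>The representing vector minimizes \<open>J\<close>. The parallelogram identity
  \<open>par\<close> makes a minimizing sequence Cauchy, completeness gives the minimizer, and the
  vanishing first variation is the representation.\<close>

lemma riesz_representation:
  fixes l :: "'h::{real_inner, complete_space} \<Rightarrow> real"
  assumes "bounded_linear l"
  obtains h where "\<And>x. l x = x \<bullet> h"
proof -
  interpret l: bounded_linear l by fact
  define J where "J x = x \<bullet> x - 2 * l x" for x
  obtain C where C: "\<And>x. norm (l x) \<le> norm x * C" "C > 0"
    using l.pos_bounded by blast
  have "- (C\<^sup>2) \<le> J x" for x
  proof -
    have "0 \<le> (norm x - C)\<^sup>2" by simp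
    moreover have "l x \<le> norm x * C" using C(1)[of x] by simp
    ultimately show ?thesis
      by (simp add: J_def power2_diff dot_square_norm algebra_simps)
  qed
  then have bdd: "bdd_below (range J)" by (intro bdd_belowI2)
  define I where "I = Inf (range J)"
  have I: "I \<le> J x" for x unfolding I_def by (intro cINF_lower bdd) auto
  have "\<exists>x. J x < I + 1 / Suc n" for n
    using cINF_less_iff[OF _ bdd, of "I + 1 / Suc n"] by (simp add: I_def)
  then obtain x where x: "\<And>n. J (x n) < I + 1 / Suc n" by metis
  have par: "(norm (a - b))\<^sup>2 = 2 * (J a + J b) - 4 * J ((1/2) *\<^sub>R (a + b))" for a b
    by (simp add: J_def power2_norm_eq_inner algebra_simps inner_commute l.add l.scaleR)
  have cau: "(norm (x i - x j))\<^sup>2 \<le> 4 / Suc n" if "i \<ge> n" "j \<ge> n" for i j n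
  proof -
    have "1 / Suc i \<le> 1 / Suc n" "1 / Suc j \<le> 1 / Suc n"
      using that by (auto simp: frac_le)
    then show ?thesis
      using par[of "x i" "x j"] x[of i] x[of j] I[of "(1/2) *\<^sub>R (x i + x j)"] by simp
  qed
  have "Cauchy x"
  proof (rule CauchyI)
    fix e :: real assume "e > 0"
    then obtain n where n: "4 / e\<^sup>2 < real n" using reals_Archimedean2 by blast
    have "4 / Suc n < e\<^sup>2"
    proof -
      have "4 < e\<^sup>2 * real n" using n \<open>e > 0\<close> by (simp add: field_simps)
      also have "\<dots> \<le> e\<^sup>2 * Suc n" by (intro mult_left_mono) auto
      finally show ?thesis by (simp add: field_simps)
    qed
    then have "norm (x i - x j) < e" if "i \<ge> n" "j \<ge> n" for i j
      using cau[OF that] \<open>e > 0\<close> by (intro power_less_imp_less_base[of _ 2 e]) auto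
    then show "\<exists>M. \<forall>m\<ge>M. \<forall>n\<ge>M. norm (x m - x n) < e" by blast
  qed
  then obtain h where h: "x \<longlonglongrightarrow> h"
    using Cauchy_convergent_iff convergentD by blast
  have "(\<lambda>n. J (x n)) \<longlonglongrightarrow> J h"
    unfolding J_def by (intro tendsto_intros h l.tendsto)
  moreover have "(\<lambda>n. I + 1 / Suc n) \<longlonglongrightarrow> I + 0"
    using LIMSEQ_inverse_real_of_nat by (intro tendsto_intros) (simp add: inverse_eq_divide)
  ultimately have "J h \<le> I"
    using x by (intro LIMSEQ_le[of "\<lambda>n. J (x n)" _ "\<lambda>n. I + 1 / Suc n"]) (auto intro: less_imp_le)
  then have min: "J h \<le> J y" for y using I[of y] by simp
  have "l y = y \<bullet> h" for y
  proof (rule ccontr)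
    assume ne: "l y \<noteq> y \<bullet> h"
    define d where "d = l y - y \<bullet> h"
    have y0: "y \<noteq> 0" using ne l.zero by auto
    \<comment> \<open>The minimizer of \<open>J\<close> along the line through \<open>h\<close> in
      direction \<open>y\<close>.\<close>
    define t where "t = d / (y \<bullet> y)"
    have "J (h + t *\<^sub>R y) = J h - 2 * t * d + t\<^sup>2 * (y \<bullet> y)"
      by (simp add: J_def d_def inner_add_left inner_add_right inner_commute l.add l.scaleR
          power2_eq_square algebra_simps)
    also have "\<dots> = J h - d\<^sup>2 / (y \<bullet> y)"
      using y0 by (simp add: t_def power2_eq_square field_simps)
    also have "\<dots> < J h" using ne y0 by (simp add: d_def)
    finally show False using min[of "h + t *\<^sub>R y"] by simp
  qed
  then show ?thesis using that by blast
qed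

lemma bounded_family_convergent_subseq:
  fixes c :: "nat \<Rightarrow> nat \<Rightarrow> real"
  assumes "\<And>i. i < p \<Longrightarrow> bounded (range (\<lambda>n. c n i))"
  obtains r g where "strict_mono r" "\<And>i. i < p \<Longrightarrow> (\<lambda>n. c (r n) i) \<longlonglongrightarrow> g i"
proof -
  have "\<exists>r g. strict_mono (r :: nat \<Rightarrow> nat) \<and> (\<forall>i<p. (\<lambda>n. c (r n) i) \<longlonglongrightarrow> g i)"
    using assms
  proof (induction p)
    case 0
    show ?case by (intro exI[of _ id]) (simp add: strict_mono_def)
  next
    case (Suc p)
    then obtain r g where r: "strict_mono (r :: nat \<Rightarrow> nat)" "\<And>i. i < p \<Longrightarrow> (\<lambda>n. c (r n) i) \<longlonglongrightarrow> g i"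
      by fastforce
    have "bounded (range (\<lambda>n. c (r n) p))"
      using Suc.prems[of p] by (rule bounded_subset) auto
    then obtain l s where s: "strict_mono (s :: nat \<Rightarrow> nat)" "((\<lambda>n. c (r n) p) \<circ> s) \<longlonglongrightarrow> l"
      using bounded_imp_convergent_subsequence by blast
    show ?case
    proof (intro exI[of _ "r \<circ> s"] exI[of _ "g(p := l)"] conjI allI impI)
      show "strict_mono (r \<circ> s)" using r(1) s(1) by (rule strict_mono_o)
      fix i assume "i < Suc p"
      then show "(\<lambda>n. c ((r \<circ> s) n) i) \<longlonglongrightarrow> (g(p := l)) i"
        using s(2) LIMSEQ_subseq_LIMSEQ[OF r(2) s(1)] by (cases "i = p") (auto simp: o_def)
    qed
  qed
  then show ?thesis using that by blast
qed

text \<open>The coefficients of a maximizing sequence of the Rayleigh quotient converge along a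
  subsequence, hence so does its image under the finite rank operator; this replaces compactness
  of the unit sphere.\<close>
lemma finite_rank_top_eigenvector:
  fixes w :: "nat \<Rightarrow> 'h::real_inner" and p :: nat
  defines "T \<equiv> \<lambda>v. \<Sum>i<p. (w i \<bullet> v) *\<^sub>R w i"
  assumes c: "c \<ge> 0" and u: "u \<bullet> T u > c * (u \<bullet> u)"
  obtains \<beta> v where "\<beta> > c" "v \<noteq> 0" "T v = \<beta> *\<^sub>R v"
proof -
  have quad: "v \<bullet> T v = (\<Sum>i<p. (w i \<bullet> v)\<^sup>2)" for v
    by (simp add: T_def inner_sum_right power2_eq_square inner_commute)
  have bil: "a \<bullet> T v = (\<Sum>i<p. (w i \<bullet> a) * (w i \<bullet> v))" for a v
    by (simp add: T_def inner_sum_right inner_commute mult.commute)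
  define R where "R = (\<lambda>v. v \<bullet> T v) ` {v. norm v = 1}"
  have "v \<bullet> T v \<le> (\<Sum>i<p. (norm (w i))\<^sup>2)" if "norm v = 1" for v
    unfolding quad
  proof (intro sum_mono)
    fix i
    have "\<bar>w i \<bullet> v\<bar> \<le> norm (w i)" using Cauchy_Schwarz_ineq2[of "w i" v] that by simp
    then show "(w i \<bullet> v)\<^sup>2 \<le> (norm (w i))\<^sup>2" using abs_le_square_iff by fastforce
  qed
  then have bdd: "bdd_above R" unfolding R_def by (intro bdd_aboveI2) auto
  define \<beta> where "\<beta> = Sup R"
  have scale: "T (s *\<^sub>R v) = s *\<^sub>R T v" for s v
    by (simp add: T_def scaleR_sum_right)
  have u0: "u \<noteq> 0" using u by (auto simp: T_def)
  have ray: "v \<bullet> T v \<le> \<beta> * (norm v)\<^sup>2" for v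
  proof (cases "v = 0")
    case False
    have "(v /\<^sub>R norm v) \<bullet> T (v /\<^sub>R norm v) \<le> \<beta>"
      unfolding \<beta>_def R_def[symmetric] using False
      by (intro cSup_upper bdd) (auto simp: R_def simp del: inner_scaleR_left)
    then show ?thesis using False by (simp add: scale field_simps power2_eq_square)
  qed auto
  have "c * (u \<bullet> u) < \<beta> * (u \<bullet> u)"
    using u ray[of u] by (simp add: dot_square_norm)
  then have "c < \<beta>" using u0 by simp
  then have b0: "\<beta> > 0" using c by simp
  \<comment> \<open>Cauchy-Schwarz for the semidefinite form \<open>a \<bullet> T b\<close>, applied
    to \<open>T v\<close> and \<open>v\<close>; the factor \<open>T v \<bullet> T (T v)\<close> is
    bounded by the Rayleigh quotient.\<close>
  have Tn: "(norm (T v))\<^sup>2 \<le> \<beta> * (v \<bullet> T v)" for v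
  proof -
    have "(T v \<bullet> T v)\<^sup>2 \<le> (T v \<bullet> T (T v)) * (v \<bullet> T v)"
      unfolding bil[of "T v" v] bil[of "T v" "T v"] bil[of v v] power2_eq_square[of "w _ \<bullet> _", symmetric]
      by (rule Cauchy_Schwarz_ineq_sum)
    also have "\<dots> \<le> (\<beta> * (norm (T v))\<^sup>2) * (v \<bullet> T v)"
      by (intro mult_right_mono ray) (simp add: quad sum_nonneg)
    finally have *: "(norm (T v))\<^sup>2 * (norm (T v))\<^sup>2 \<le> (norm (T v))\<^sup>2 * (\<beta> * (v \<bullet> T v))"
      by (simp add: dot_square_norm power2_eq_square algebra_simps)
    have "0 \<le> \<beta> * (v \<bullet> T v)" using b0 by (simp add: quad sum_nonneg)
    with * show ?thesis
      using mult_le_cancel_left_pos[of "(norm (T v))\<^sup>2" "(norm (T v))\<^sup>2" "\<beta> * (v \<bullet> T v)"]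
      by (cases "T v = 0") (auto simp del: mult_le_cancel_left_pos)
  qed
  have "R \<noteq> {}" using u0 by (auto simp: R_def intro!: exI[of _ "u /\<^sub>R norm u"])
  then have "\<exists>v. norm v = 1 \<and> v \<bullet> T v > \<beta> - 1 / Suc n" for n
    using less_cSup_iff[OF _ bdd, of "\<beta> - 1 / Suc n"] by (auto simp: R_def \<beta>_def)
  then obtain v where v: "\<And>n. norm (v n) = 1" "\<And>n. v n \<bullet> T (v n) > \<beta> - 1 / Suc n"
    by metis
  have "bounded (range (\<lambda>n. w i \<bullet> v n))" for i
    using v(1) Cauchy_Schwarz_ineq2[of "w i" "v _"] by (intro boundedI[of _ "norm (w i)"]) auto
  then obtain r g where r: "strict_mono r" "\<And>i. i < p \<Longrightarrow> (\<lambda>n. w i \<bullet> v (r n)) \<longlonglongrightarrow> g i"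
    using bounded_family_convergent_subseq[of p "\<lambda>n i. w i \<bullet> v n"] by blast
  define y where "y = (\<Sum>i<p. g i *\<^sub>R w i)"
  have y: "(\<lambda>n. T (v (r n))) \<longlonglongrightarrow> y"
    unfolding T_def y_def by (intro tendsto_intros r(2)) auto
  \<comment> \<open>By \<open>Tn\<close> the residual is at most
    \<open>\<beta> * (\<beta> - v n \<bullet> T (v n))\<close>, so a maximizing sequence consists of
    approximate eigenvectors.\<close>
  have res: "(norm (T (v n) - \<beta> *\<^sub>R v n))\<^sup>2 \<le> \<beta> / Suc n" for n
  proof -
    have "v n \<bullet> v n = 1" using v(1)[of n] by (simp add: dot_square_norm)
    then have "(norm (T (v n) - \<beta> *\<^sub>R v n))\<^sup>2 = (norm (T (v n)))\<^sup>2 - 2 * \<beta> * (v n \<bullet> T (v n)) + \<beta>\<^sup>2"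
      unfolding power2_norm_eq_inner
      by (simp add: inner_diff inner_commute power2_eq_square algebra_simps)
    also have "\<dots> \<le> \<beta> * (\<beta> - v n \<bullet> T (v n))"
      using Tn[of "v n"] by (simp add: power2_eq_square algebra_simps)
    also have "\<dots> \<le> \<beta> * (1 / Suc n)"
      using v(2)[of n] b0 by (intro mult_left_mono) auto
    finally show ?thesis by simp
  qed
  have "(\<lambda>n. \<beta> / Suc n) \<longlonglongrightarrow> 0"
    using tendsto_mult[OF tendsto_const[of \<beta>] LIMSEQ_inverse_real_of_nat] by (simp add: divide_inverse)
  then have "(\<lambda>n. (norm (T (v n) - \<beta> *\<^sub>R v n))\<^sup>2) \<longlonglongrightarrow> 0"
    by (rule tendsto_sandwich[OF _ _ tendsto_const, rotated -1]) (simp_all add: eventuallyI[OF res] del: of_nat_Suc)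
  from tendsto_real_sqrt[OF this] have "(\<lambda>n. T (v n) - \<beta> *\<^sub>R v n) \<longlonglongrightarrow> 0"
    by (simp add: tendsto_norm_zero_iff)
  then have "(\<lambda>n. T (v (r n)) - \<beta> *\<^sub>R v (r n)) \<longlonglongrightarrow> 0"
    using LIMSEQ_subseq_LIMSEQ[OF _ r(1)] by (fastforce simp: o_def)
  \<comment> \<open>Since \<beta> > 0, \<open>v\<close> is recovered from \<open>T v\<close> and the
    residual, both of which converge along the subsequence.\<close>
  then have "(\<lambda>n. (1 / \<beta>) *\<^sub>R (T (v (r n)) - (T (v (r n)) - \<beta> *\<^sub>R v (r n)))) \<longlonglongrightarrow> (1 / \<beta>) *\<^sub>R (y - 0)"
    by (intro tendsto_intros y)
  then have lim: "(\<lambda>n. v (r n)) \<longlonglongrightarrow> (1 / \<beta>) *\<^sub>R y"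
    using b0 by simp
  then have "(\<lambda>n. T (v (r n))) \<longlonglongrightarrow> T ((1 / \<beta>) *\<^sub>R y)"
    unfolding T_def by (intro tendsto_intros)
  then have "T ((1 / \<beta>) *\<^sub>R y) = y" using y LIMSEQ_unique by blast
  moreover have "norm ((1 / \<beta>) *\<^sub>R y) = 1"
    using tendsto_norm[OF lim] unfolding v(1) LIMSEQ_const_iff by (rule sym)
  moreover from this have "(1 / \<beta>) *\<^sub>R y \<noteq> 0" by force
  moreover have "\<beta> *\<^sub>R (1 / \<beta>) *\<^sub>R y = y" using b0 by simp
  ultimately show ?thesis
    using that[of \<beta> "(1 / \<beta>) *\<^sub>R y"] \<open>c < \<beta>\<close> by metis
qed

section \<open>Concentration of empirical means\<close>

text \<open>McDiarmid's condition controls differences only. They confine \<open>h\<close> to the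
  interval from its infimum \<open>a\<close> to \<open>a + c\<close>, and the usual Hoeffding lemma
  depends on the width alone.\<close>

lemma Hoeffdings_lemma_oscillation:
  fixes h :: "'a \<Rightarrow> real"
  assumes "prob_space P" and [measurable]: "h \<in> borel_measurable P"
    and osc: "\<And>y y'. y \<in> space P \<Longrightarrow> y' \<in> space P \<Longrightarrow> h y - h y' \<le> c"
    and l: "l > 0"
  shows "(LINT y|P. exp (l * (h y - (LINT z|P. h z)))) \<le> exp (l\<^sup>2 * c\<^sup>2 / 8)"
proof -
  interpret prob_space P by fact
  obtain y0 where y0: "y0 \<in> space P" using not_empty by blast
  define a where "a = Inf (h ` space P)"
  have bdd: "bdd_below (h ` space P)"
    using osc[OF y0] by (intro bdd_belowI2[of _ "h y0 - c"]) (auto simp: algebra_simps)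
  have lo: "a \<le> h y" if "y \<in> space P" for y
    unfolding a_def using that bdd by (intro cINF_lower)
  have "h y - c \<le> a" if "y \<in> space P" for y
    unfolding a_def using that osc[of y] y0 by (intro cINF_greatest) (auto simp: algebra_simps)
  then have hi: "h y \<le> a + c" if "y \<in> space P" for y using that by force
  interpret h: interval_bounded_random_variable P h a "a + c"
    by unfold_locales (auto intro!: AE_I2 lo hi)
  have bnd: "exp (l * (h y - expectation h)) \<le> exp (l * (a + c - expectation h))" if "y \<in> space P" for y
    using hi[OF that] l by simp
  have "integrable P (\<lambda>y. exp (l * (h y - expectation h)))"
    by (rule integrable_const_bound[of _ "exp (l * (a + c - expectation h))"])
      (use bnd in \<open>auto intro!: AE_I2\<close>)
  then have "ennreal (LINT y|P. exp (l * (h y - expectation h)))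
      = (\<integral>\<^sup>+y. exp (l * (h y - expectation h)) \<partial>P)"
    by (subst nn_integral_eq_integral) auto
  also have "\<dots> \<le> ennreal (exp (l\<^sup>2 * (a + c - a)\<^sup>2 / 8))"
    by (rule h.Hoeffdings_lemma_nn_integral[OF l])
  finally show ?thesis by (simp add: ennreal_le_iff)
qed

text \<open>Induction on the coordinates in place of a martingale. The partial mean \<open>g\<close>
  over the last coordinate inherits the bound and the oscillation, and Hoeffding's lemma in that
  coordinate contributes one factor \<open>exp (l\<^sup>2 * c\<^sup>2 / 8)\<close>.\<close>

lemma McDiarmid_exponential_moment:
  fixes f :: "(nat \<Rightarrow> 'a) \<Rightarrow> real"
  assumes P: "prob_space P" and l: "l > 0"
    and f: "f \<in> borel_measurable (PiM {..<n} (\<lambda>_. P))"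
    and bound: "\<And>x. x \<in> space (PiM {..<n} (\<lambda>_. P)) \<Longrightarrow> \<bar>f x\<bar> \<le> b"
    and osc: "\<And>x i y y'. x \<in> space (PiM {..<n} (\<lambda>_. P)) \<Longrightarrow> i < n \<Longrightarrow> y \<in> space P \<Longrightarrow>
       y' \<in> space P \<Longrightarrow> f (x(i := y)) - f (x(i := y')) \<le> c"
  shows "(LINT x|PiM {..<n} (\<lambda>_. P). exp (l * (f x - (LINT z|PiM {..<n} (\<lambda>_. P). f z))))
     \<le> exp (l\<^sup>2 * real n * c\<^sup>2 / 8)"
  using f bound osc
proof (induction n arbitrary: f)
  case 0
  have "(LINT x|PiM {} (\<lambda>_. P). exp (l * (f x - (LINT z|PiM {} (\<lambda>_. P). f z)))) = 1"
    by (simp add: PiM_empty lebesgue_integral_count_space_finite)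
  then show ?case by simp
next
  case (Suc n)
  interpret P: prob_space P by (rule P)
  interpret product_sigma_finite "\<lambda>_::nat. P" by unfold_locales
  let ?M = "PiM {..<n} (\<lambda>_. P)" and ?M' = "PiM {..<Suc n} (\<lambda>_. P)"
  interpret M: prob_space ?M by (rule prob_space_PiM) (rule P)
  interpret M': prob_space ?M' by (rule prob_space_PiM) (rule P)
  note [measurable] = Suc.prems(1)
  have ins: "{..<Suc n} = insert n {..<n}" by auto
  have upd [measurable]: "(\<lambda>(x, y). x(n := y)) \<in> measurable (?M \<Otimes>\<^sub>M P) ?M'"
    unfolding ins by measurable
  have updx: "x(n := y) \<in> space ?M'" if "x \<in> space ?M" "y \<in> space P" for x y
    using measurable_space[OF upd, of "(x, y)"] that by (simp add: space_pair_measure)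
  have fm [measurable]: "(\<lambda>(x, y). f (x(n := y))) \<in> borel_measurable (?M \<Otimes>\<^sub>M P)"
    using measurable_comp[OF upd Suc.prems(1)] by (simp add: comp_def case_prod_unfold)
  have fmx [measurable]: "(\<lambda>y. f (x(n := y))) \<in> borel_measurable P" if "x \<in> space ?M" for x
    using measurable_Pair2[OF fm that] by simp
  define g where "g x = (LINT y|P. f (x(n := y)))" for x
  have gm [measurable]: "g \<in> borel_measurable ?M"
    unfolding g_def by measurable
  have fb: "\<bar>f (x(n := y))\<bar> \<le> b" if "x \<in> space ?M" "y \<in> space P" for x y
    by (rule Suc.prems(2)[OF updx[OF that]])
  have int: "integrable P (\<lambda>y. f (x(n := y)))" if "x \<in> space ?M" for x
  proof (rule P.integrable_const_bound[of _ b])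
    show "AE y in P. norm (f (x(n := y))) \<le> b"
      using fb[OF that] by (intro AE_I2) simp
  qed (rule fmx[OF that])
  have intf: "integrable ?M' f"
    using Suc.prems(2) by (intro M'.integrable_const_bound[of _ b]) (auto intro!: AE_I2)
  have gb: "\<bar>g x\<bar> \<le> b" if "x \<in> space ?M" for x
  proof -
    have "\<bar>g x\<bar> \<le> (LINT y|P. \<bar>f (x(n := y))\<bar>)" unfolding g_def by (rule integral_abs_bound)
    also have "\<dots> \<le> (LINT y|P. b)"
      using fb[OF that] int[OF that] by (intro integral_mono) auto
    finally show ?thesis by (simp add: P.prob_space)
  qed
  have Eg: "(LINT z|?M'. f z) = (LINT x|?M. g x)"
    using product_integral_insert[of "{..<n}" n f] intf by (simp add: ins g_def)
  define E where "E = (LINT x|?M. g x)"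
  have expm [measurable]: "(\<lambda>z. exp (l * (f z - E))) \<in> borel_measurable ?M'" by measurable
  have expb: "\<bar>exp (l * (f z - E))\<bar> \<le> exp (l * (b - E))" if "z \<in> space ?M'" for z
    using Suc.prems(2)[OF that] l by (simp add: abs_le_iff)
  have inte: "integrable ?M' (\<lambda>z. exp (l * (f z - E)))"
    by (rule M'.integrable_const_bound[of _ "exp (l * (b - E))"]) (use expb in \<open>auto intro!: AE_I2\<close>)
  have "(LINT z|?M'. exp (l * (f z - E))) = (LINT x|?M. LINT y|P. exp (l * (f (x(n := y)) - E)))"
    using product_integral_insert[of "{..<n}" n "\<lambda>z. exp (l * (f z - E))"] inte by (simp add: ins)
  \<comment> \<open>For fixed \<open>x\<close>, \<open>f - E\<close> splits into
    \<open>f - g x\<close>, centred in the last coordinate, and \<open>g x - E\<close>, constant in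
    it.\<close>
  also have "\<dots> \<le> (LINT x|?M. exp (l\<^sup>2 * c\<^sup>2 / 8) * exp (l * (g x - E)))"
  proof (rule integral_mono)
    have b1: "\<bar>LINT y|P. exp (l * (f (x(n := y)) - E))\<bar> \<le> exp (l * (b - E))" if x: "x \<in> space ?M" for x
    proof -
      note [measurable] = fmx[OF x]
      have "\<bar>LINT y|P. exp (l * (f (x(n := y)) - E))\<bar> \<le> (LINT y|P. exp (l * (b - E)))"
        using expb[OF updx[OF x]]
        by (intro order_trans[OF integral_abs_bound] integral_mono
            P.integrable_const_bound[of _ "exp (l * (b - E))"]) (auto intro!: AE_I2)
      then show ?thesis by (simp add: P.prob_space)
    qed
    have m1: "(\<lambda>x. LINT y|P. exp (l * (f (x(n := y)) - E))) \<in> borel_measurable ?M"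
      by measurable
    show "integrable ?M (\<lambda>x. LINT y|P. exp (l * (f (x(n := y)) - E)))"
      by (rule M.integrable_const_bound[of _ "exp (l * (b - E))"]) (use b1 m1 in \<open>auto intro!: AE_I2\<close>)
    have "\<bar>exp (l * (g x - E))\<bar> \<le> exp (l * (b - E))" if "x \<in> space ?M" for x
      using gb[OF that] l by (simp add: abs_le_iff)
    then have "integrable ?M (\<lambda>x. exp (l * (g x - E)))"
      by (intro M.integrable_const_bound[of _ "exp (l * (b - E))"]) (auto intro!: AE_I2)
    then show "integrable ?M (\<lambda>x. exp (l\<^sup>2 * c\<^sup>2 / 8) * exp (l * (g x - E)))" by simp
    fix x assume x: "x \<in> space ?M"
    obtain y0 where y0: "y0 \<in> space P" using P.not_empty by blast
    have "(LINT y|P. exp (l * (f (x(n := y)) - E)))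
        = (LINT y|P. exp (l * (g x - E)) * exp (l * (f (x(n := y)) - g x)))"
      by (simp add: exp_add[symmetric] algebra_simps)
    also have "\<dots> = exp (l * (g x - E)) * (LINT y|P. exp (l * (f (x(n := y)) - g x)))"
      by simp
    also have "\<dots> \<le> exp (l * (g x - E)) * exp (l\<^sup>2 * c\<^sup>2 / 8)"
      unfolding g_def
    proof (intro mult_left_mono Hoeffdings_lemma_oscillation P fmx x l)
      fix y y' assume "y \<in> space P" "y' \<in> space P"
      then show "f (x(n := y)) - f (x(n := y')) \<le> c"
        using Suc.prems(3)[OF updx[OF x y0], of n y y'] by (simp only: fun_upd_upd)
    qed simp
    finally show "(LINT y|P. exp (l * (f (x(n := y)) - E))) \<le> exp (l\<^sup>2 * c\<^sup>2 / 8) * exp (l * (g x - E))"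
      by (simp add: mult.commute)
  qed
  also have "\<dots> = exp (l\<^sup>2 * c\<^sup>2 / 8) * (LINT x|?M. exp (l * (g x - E)))" by simp
  also have "\<dots> \<le> exp (l\<^sup>2 * c\<^sup>2 / 8) * exp (l\<^sup>2 * real n * c\<^sup>2 / 8)"
    unfolding E_def
  proof (intro mult_left_mono Suc.IH gm gb)
    fix x i y y' assume x: "x \<in> space ?M" and i: "i < n" and y: "y \<in> space P" "y' \<in> space P"
    have x': "x(i := u) \<in> space ?M" if "u \<in> space P" for u
      using x i that by (auto simp: space_PiM PiE_iff extensional_def)
    have "g (x(i := y)) - g (x(i := y')) = (LINT z|P. f ((x(i := y))(n := z)) - f ((x(i := y'))(n := z)))"
      unfolding g_def using x' y by (intro Bochner_Integration.integral_diff[symmetric] int) auto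
    also have "\<dots> \<le> (LINT z|P. c)"
    proof (intro integral_mono Bochner_Integration.integrable_diff int x' y)
      fix z assume z: "z \<in> space P"
      show "f ((x(i := y))(n := z)) - f ((x(i := y'))(n := z)) \<le> c"
        using Suc.prems(3)[OF updx[OF x z], of i y y'] i y by (simp add: fun_upd_twist[of i n] del: fun_upd_apply)
    qed auto
    finally show "g (x(i := y)) - g (x(i := y')) \<le> c" by (simp add: P.prob_space)
  qed auto
  also have "\<dots> = exp (l\<^sup>2 * real (Suc n) * c\<^sup>2 / 8)"
    by (simp add: exp_add[symmetric] field_simps)
  finally show ?case by (simp add: Eg E_def)
qed

lemma McDiarmid_inequality:
  fixes f :: "(nat \<Rightarrow> 'a) \<Rightarrow> real"
  defines "M \<equiv> \<lambda>n P. PiM {..<n} (\<lambda>_. P :: 'a measure)"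
  assumes P: "prob_space P" and n: "n > 0" and c: "c > 0" and t: "t > 0"
    and f: "f \<in> borel_measurable (M n P)"
    and bound: "\<And>x. x \<in> space (M n P) \<Longrightarrow> \<bar>f x\<bar> \<le> b"
    and osc: "\<And>x i y y'. x \<in> space (M n P) \<Longrightarrow> i < n \<Longrightarrow> y \<in> space P \<Longrightarrow>
       y' \<in> space P \<Longrightarrow> f (x(i := y)) - f (x(i := y')) \<le> c"
  shows "measure (M n P) {x \<in> space (M n P). f x \<ge> (LINT z|M n P. f z) + t}
     \<le> exp (- 2 * t\<^sup>2 / (real n * c\<^sup>2))"
proof -
  interpret M: prob_space "M n P" unfolding M_def by (rule prob_space_PiM) (rule P)
  note [measurable] = f
  define E where "E = (LINT z|M n P. f z)"
  \<comment> \<open>The minimizer of the Chernoff exponent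
    \<open>l\<^sup>2 * n * c\<^sup>2 / 8 - l * t\<close>.\<close>
  define l where "l = 4 * t / (real n * c\<^sup>2)"
  have l: "l > 0" using n c t by (simp add: l_def)
  have "\<bar>exp (l * (f x - E))\<bar> \<le> exp (l * (b - E))" if "x \<in> space (M n P)" for x
    using bound[OF that] l by (simp add: abs_le_iff)
  then have int: "integrable (M n P) (\<lambda>x. exp (l * (f x - E)))"
    by (intro M.integrable_const_bound[of _ "exp (l * (b - E))"]) (auto intro!: AE_I2)
  have "{x \<in> space (M n P). f x \<ge> E + t} = {x \<in> space (M n P). exp (l * (f x - E)) \<ge> exp (l * t)}"
    using l by (simp add: le_diff_eq add.commute)
  then have "M.prob {x \<in> space (M n P). f x \<ge> E + t} \<le> (LINT x|M n P. exp (l * (f x - E))) / exp (l * t)"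
    using integral_Markov_inequality_measure[OF int, of "{}" "exp (l * t)"] by simp
  also have "\<dots> \<le> exp (l\<^sup>2 * real n * c\<^sup>2 / 8) / exp (l * t)"
    using McDiarmid_exponential_moment[OF P l, of f n b c] assms(6-8)
    unfolding E_def M_def by (intro divide_right_mono) auto
  also have "\<dots> = exp (l\<^sup>2 * real n * c\<^sup>2 / 8 - l * t)" by (simp add: exp_diff)
  also have "l\<^sup>2 * real n * c\<^sup>2 / 8 - l * t = - 2 * t\<^sup>2 / (real n * c\<^sup>2)"
    using n c by (simp add: l_def power2_eq_square field_simps)
  finally show ?thesis by (simp add: E_def)
qed

text \<open>Independence enters through Fubini: the cross term with a new coordinate integrates to 0
  since \<open>h\<close> has mean 0.\<close>

lemma variance_sum_PiM:
  fixes h :: "'a \<Rightarrow> real"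
  assumes P: "prob_space P" and [measurable]: "h \<in> borel_measurable P"
    and bound: "\<And>x. x \<in> space P \<Longrightarrow> \<bar>h x\<bar> \<le> b" and mean: "(LINT x|P. h x) = 0"
  shows "(LINT x|PiM {..<n} (\<lambda>_. P). (\<Sum>i<n. h (x i))\<^sup>2) = real n * (LINT y|P. (h y)\<^sup>2)"
proof (induction n)
  case 0
  then show ?case by simp
next
  case (Suc n)
  interpret P: prob_space P by (rule P)
  interpret product_sigma_finite "\<lambda>_::nat. P" by unfold_locales
  let ?M = "PiM {..<n} (\<lambda>_. P)" and ?M' = "PiM {..<Suc n} (\<lambda>_. P)"
  interpret M: prob_space ?M by (rule prob_space_PiM) (rule P)
  interpret M': prob_space ?M' by (rule prob_space_PiM) (rule P)
  have ins: "{..<Suc n} = insert n {..<n}" by auto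
  have Sm [measurable]: "(\<lambda>x. \<Sum>i<k. h (x i)) \<in> borel_measurable (PiM {..<k} (\<lambda>_. P))" for k :: nat
    by measurable
  have Sb: "\<bar>\<Sum>i<k. h (x i)\<bar> \<le> real k * b" if "x \<in> space (PiM {..<k} (\<lambda>_. P))" for x and k :: nat
    using that by (intro order_trans[OF sum_abs] order_trans[OF sum_bounded_above[of _ _ b]])
      (auto intro!: bound simp: space_PiM PiE_iff)
  have sqb: "\<bar>u\<^sup>2\<bar> \<le> v\<^sup>2" if "\<bar>u\<bar> \<le> v" for u v :: real
    using that power_mono[of "\<bar>u\<bar>" v 2] by simp
  have intS: "integrable (PiM {..<k} (\<lambda>_. P)) (\<lambda>x. (\<Sum>i<k. h (x i))\<^sup>2)" for k :: nat
  proof -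
    interpret prob_space "PiM {..<k} (\<lambda>_. P)" by (rule prob_space_PiM) (rule P)
    show ?thesis
      using sqb[OF Sb] by (intro integrable_const_bound[of _ "(real k * b)\<^sup>2"]) (auto intro!: AE_I2)
  qed
  have inth: "integrable P h" "integrable P (\<lambda>y. (h y)\<^sup>2)"
    using bound sqb[OF bound]
    by (auto intro!: AE_I2 P.integrable_const_bound[of h b] P.integrable_const_bound[of "\<lambda>y. (h y)\<^sup>2" "b\<^sup>2"])
  have "(LINT x|?M'. (\<Sum>i<Suc n. h (x i))\<^sup>2) = (LINT x|?M. LINT y|P. (\<Sum>i<Suc n. h ((x(n := y)) i))\<^sup>2)"
    using product_integral_insert[of "{..<n}" n "\<lambda>x. (\<Sum>i<Suc n. h (x i))\<^sup>2"] intS[of "Suc n"]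
    by (simp add: ins)
  also have "\<dots> = (LINT x|?M. LINT y|P. (\<Sum>i<n. h (x i))\<^sup>2 + 2 * (\<Sum>i<n. h (x i)) * h y + (h y)\<^sup>2)"
    by (simp add: power2_sum algebra_simps)
  also have "\<dots> = (LINT x|?M. (\<Sum>i<n. h (x i))\<^sup>2 + (LINT y|P. (h y)\<^sup>2))"
    using inth mean by (simp add: P.prob_space)
  also have "\<dots> = real n * (LINT y|P. (h y)\<^sup>2) + (LINT y|P. (h y)\<^sup>2)"
    using intS[of n] Suc.IH by (simp add: M.prob_space)
  finally show ?case by (simp add: algebra_simps)
qed

text \<open>\<open>f\<close> is the Euclidean norm of the error of a vector-valued empirical mean.
  Jensen's inequality and the variance bound its mean by \<open>R / sqrt p\<close>; McDiarmid bounds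
  the fluctuation. Neither bound depends on the size of \<open>I\<close>, which later grows without
  limit.\<close>

lemma empirical_mean_concentration:
  fixes g :: "'i \<Rightarrow> 'a \<Rightarrow> real" and P :: "'a measure" and I :: "'i set" and p :: nat
  defines "M \<equiv> PiM {..<p} (\<lambda>_. P)"
    and "f \<equiv> \<lambda>xs. L2_set (\<lambda>i. (LINT y|P. g i y) - (\<Sum>k<p. g i (xs k)) / real p) I"
  assumes P: "prob_space P" and I: "finite I" and g [measurable]: "\<And>i. g i \<in> borel_measurable P"
    and bound: "\<And>x. x \<in> space P \<Longrightarrow> L2_set (\<lambda>i. g i x) I \<le> R" and R: "R > 0"
    and p: "p > 0" and \<alpha>: "\<alpha> > 0"
  shows "measure M {xs \<in> space M. f xs \<le> 2 * R / sqrt p * (1 + sqrt (\<alpha> / 2))} \<ge> 1 - exp (- \<alpha>)"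
proof -
  interpret P: prob_space P by (rule P)
  interpret M: prob_space M unfolding M_def by (rule prob_space_PiM) (rule P)
  have comp: "xs k \<in> space P" if "xs \<in> space M" "k < p" for xs k
    using that by (auto simp: M_def space_PiM PiE_iff)
  have upd: "xs(k := y) \<in> space M" if "xs \<in> space M" "k < p" "y \<in> space P" for xs k y
    using that by (auto simp: M_def space_PiM PiE_iff extensional_def)
  have gb: "\<bar>g i x\<bar> \<le> R" if "i \<in> I" "x \<in> space P" for i x
    using member_le_L2_set[OF I that(1), of "\<lambda>i. \<bar>g i x\<bar>"] bound[OF that(2)]
    by (simp add: L2_set_def)
  have gint: "integrable P (g i)" "integrable P (\<lambda>y. (g i y)\<^sup>2)" if "i \<in> I" for i
    using gb[OF that] power_mono[OF gb[OF that], of _ 2]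
    by (auto intro!: AE_I2 P.integrable_const_bound[of "g i" R]
        P.integrable_const_bound[of "\<lambda>y. (g i y)\<^sup>2" "R\<^sup>2"])
  define D where "D i xs = (LINT y|P. g i y) - (\<Sum>k<p. g i (xs k)) / real p" for i xs
  have f: "f xs = L2_set (\<lambda>i. D i xs) I" for xs by (simp add: f_def D_def)
  have Dm [measurable]: "D i \<in> borel_measurable M" for i
    unfolding D_def M_def by measurable
  have fm [measurable]: "f \<in> borel_measurable M"
    unfolding f L2_set_def by measurable
  define h where "h i y = (LINT y|P. g i y) - g i y" for i y
  have D: "D i xs = (\<Sum>k<p. h i (xs k)) / real p" for i xs
    using p by (simp add: D_def h_def sum_subtractf field_simps)
  define b where "b = (\<Sum>i\<in>I. \<bar>LINT y|P. g i y\<bar> + R)"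
  have Db: "\<bar>D i xs\<bar> \<le> \<bar>LINT y|P. g i y\<bar> + R" if "i \<in> I" "xs \<in> space M" for i xs
  proof -
    have "\<bar>\<Sum>k<p. g i (xs k)\<bar> \<le> real p * R"
      using gb[OF that(1) comp[OF that(2)]]
      by (intro order_trans[OF sum_abs] order_trans[OF sum_bounded_above[of _ _ R]]) auto
    then have "\<bar>(\<Sum>k<p. g i (xs k)) / real p\<bar> \<le> R" using p by (simp add: field_simps)
    then show ?thesis unfolding D_def by linarith
  qed
  have fb: "\<bar>f xs\<bar> \<le> b" if "xs \<in> space M" for xs
    using L2_set_le_sum_abs[of "\<lambda>i. D i xs" I] sum_mono[of I "\<lambda>i. \<bar>D i xs\<bar>"] Db[OF _ that]
    unfolding f b_def by (auto intro: order_trans)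
  \<comment> \<open>Replacing one sample moves the empirical mean by a difference of two vectors of
    norm at most \<open>R\<close>, divided by \<open>p\<close>.\<close>
  have osc: "f (xs(k := y)) - f (xs(k := y')) \<le> 2 * R / p"
    if "xs \<in> space M" "k < p" "y \<in> space P" "y' \<in> space P" for xs k y y'
  proof -
    have split: "(\<Sum>j<p. h i ((xs(k := u)) j)) = h i u + (\<Sum>j\<in>{..<p} - {k}. h i (xs j))" for i u
      using that(2) by (subst sum.remove[of _ k]) (auto intro!: sum.cong)
    have "D i (xs(k := y)) = D i (xs(k := y')) + (g i y' / p + - g i y / p)" for i
      unfolding D split by (simp add: h_def add_divide_distrib diff_divide_distrib)
    then have "f (xs(k := y)) = L2_set (\<lambda>i. D i (xs(k := y')) + (g i y' / p + - g i y / p)) I"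
      by (simp add: f)
    also have "\<dots> \<le> f (xs(k := y')) + (L2_set (\<lambda>i. g i y' / p) I + L2_set (\<lambda>i. - g i y / p) I)"
      unfolding f by (intro order_trans[OF L2_set_triangle_ineq] add_left_mono L2_set_triangle_ineq)
    also have "L2_set (\<lambda>i. g i y' / p) I = L2_set (\<lambda>i. g i y') I / p"
      by (simp add: L2_set_right_distrib divide_inverse L2_set_left_distrib)
    also have "L2_set (\<lambda>i. - g i y / p) I = L2_set (\<lambda>i. g i y) I / p"
      using L2_set_left_distrib[of "1 / p" "\<lambda>i. g i y" I] by (simp add: L2_set_def)
    also have "L2_set (\<lambda>i. g i y') I / p + L2_set (\<lambda>i. g i y) I / p \<le> 2 * R / p"
      using bound[OF that(3)] bound[OF that(4)] by (simp add: add_divide_distrib[symmetric] divide_right_mono)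
    finally show ?thesis by linarith
  qed
  have intf: "integrable M f"
    using fb by (intro M.integrable_const_bound[of _ b]) (auto intro!: AE_I2)
  have intf2: "integrable M (\<lambda>xs. (f xs)\<^sup>2)"
    using power_mono[OF fb, of _ 2] by (intro M.integrable_const_bound[of _ "b\<^sup>2"]) (auto intro!: AE_I2)
  have intD: "integrable M (\<lambda>xs. (D i xs)\<^sup>2)" if "i \<in> I" for i
    using power_mono[OF Db[OF that], of _ 2]
    by (intro M.integrable_const_bound[of _ "(\<bar>LINT y|P. g i y\<bar> + R)\<^sup>2"]) (auto intro!: AE_I2)
  have ED: "(LINT xs|M. (D i xs)\<^sup>2) \<le> (LINT y|P. (g i y)\<^sup>2) / p" if i: "i \<in> I" for i
  proof -
    have "(LINT xs|M. (D i xs)\<^sup>2) = (LINT xs|M. (\<Sum>k<p. h i (xs k))\<^sup>2) / (real p)\<^sup>2"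
      by (simp add: D power_divide)
    also have "(LINT xs|M. (\<Sum>k<p. h i (xs k))\<^sup>2) = p * (LINT y|P. (h i y)\<^sup>2)"
      unfolding M_def
    proof (rule variance_sum_PiM[OF P, of _ "\<bar>LINT y|P. g i y\<bar> + R"])
      show "h i \<in> borel_measurable P" unfolding h_def by measurable
      show "\<bar>h i y\<bar> \<le> \<bar>LINT y|P. g i y\<bar> + R" if "y \<in> space P" for y
        using gb[OF i that] unfolding h_def by linarith
      show "(LINT y|P. h i y) = 0"
        unfolding h_def using gint[OF i] by (simp add: P.prob_space)
    qed
    also have "(LINT y|P. (h i y)\<^sup>2) = (LINT y|P. (g i y)\<^sup>2) - (LINT y|P. g i y)\<^sup>2"
      unfolding h_def using gint[OF i]
      by (simp add: power2_diff P.prob_space power2_eq_square[of "LINT y|P. g i y"] mult.assoc)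
    also have "real p * ((LINT y|P. (g i y)\<^sup>2) - (LINT y|P. g i y)\<^sup>2) / (real p)\<^sup>2
        \<le> real p * (LINT y|P. (g i y)\<^sup>2) / (real p)\<^sup>2"
      by (intro divide_right_mono mult_left_mono) auto
    also have "\<dots> = (LINT y|P. (g i y)\<^sup>2) / p" using p by (simp add: power2_eq_square[of "real p"])
    finally show ?thesis .
  qed
  have "(LINT xs|M. f xs)\<^sup>2 \<le> (LINT xs|M. (f xs)\<^sup>2)"
    using M.variance_positive[of f] M.variance_eq[OF intf intf2] by simp
  also have "\<dots> = (\<Sum>i\<in>I. LINT xs|M. (D i xs)\<^sup>2)"
    using intD by (simp add: f L2_set_def sum_nonneg)
  also have "\<dots> \<le> (\<Sum>i\<in>I. (LINT y|P. (g i y)\<^sup>2) / p)"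
    by (intro sum_mono ED)
  also have "\<dots> = (LINT y|P. (L2_set (\<lambda>i. g i y) I)\<^sup>2) / p"
    using gint by (simp add: L2_set_def sum_nonneg sum_divide_distrib)
  also have "\<dots> \<le> (LINT y|P. R\<^sup>2) / p"
  proof (intro divide_right_mono integral_mono)
    show "integrable P (\<lambda>y. (L2_set (\<lambda>i. g i y) I)\<^sup>2)"
      using gint by (simp add: L2_set_def sum_nonneg)
  qed (use bound R in \<open>auto intro!: power_mono\<close>)
  finally have "(LINT xs|M. f xs)\<^sup>2 \<le> (R / sqrt p)\<^sup>2"
    by (simp add: P.prob_space power_divide)
  then have Ef: "(LINT xs|M. f xs) \<le> R / sqrt p"
    by (rule power2_le_imp_le) (use R in simp)
  \<comment> \<open>With oscillation \<open>2 * R / p\<close> in each of \<open>p\<close>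
    coordinates, this makes McDiarmid's exponent exactly \<open>- \<alpha>\<close>.\<close>
  define t where "t = 2 * R / sqrt p * sqrt (\<alpha> / 2)"
  have t: "t > 0" using R p \<alpha> by (simp add: t_def)
  have "measure M {xs \<in> space M. f xs \<ge> (LINT xs|M. f xs) + t} \<le> exp (- 2 * t\<^sup>2 / (real p * (2 * R / p)\<^sup>2))"
    unfolding M_def
  proof (rule McDiarmid_inequality[where b = b])
    show "prob_space P" "p > 0" "t > 0" by fact+
    show "2 * R / real p > 0" using R p by simp
    show "f \<in> borel_measurable (PiM {..<p} (\<lambda>_. P))" using fm unfolding M_def .
    show "\<bar>f x\<bar> \<le> b" if "x \<in> space (PiM {..<p} (\<lambda>_. P))" for x
      using fb that unfolding M_def .
    show "f (x(k := y)) - f (x(k := y')) \<le> 2 * R / real p"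
      if "x \<in> space (PiM {..<p} (\<lambda>_. P))" "k < p" "y \<in> space P" "y' \<in> space P" for x k y y'
      using osc that unfolding M_def .
  qed
  also have "- 2 * t\<^sup>2 / (real p * (2 * R / p)\<^sup>2) = - \<alpha>"
  proof -
    have "t\<^sup>2 = 2 * R\<^sup>2 * \<alpha> / p"
      using \<alpha> by (simp add: t_def power_mult_distrib power_divide)
    then show ?thesis
      using R p by (simp add: power_mult_distrib power_divide power2_eq_square)
  qed
  finally have "1 - exp (- \<alpha>) \<le> 1 - measure M {xs \<in> space M. f xs \<ge> (LINT xs|M. f xs) + t}"
    by simp
  also have "\<dots> = measure M {xs \<in> space M. \<not> f xs \<ge> (LINT xs|M. f xs) + t}"
    by (subst M.prob_neg) auto
  also have "\<dots> \<le> measure M {xs \<in> space M. f xs \<le> 2 * R / sqrt p * (1 + sqrt (\<alpha> / 2))}"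
  proof (rule M.finite_measure_mono)
    \<comment> \<open>The bound on the mean is doubled only so that it shares its factor with the
      fluctuation term.\<close>
    have "R / sqrt p \<le> 2 * R / sqrt p" using R p by (simp add: divide_right_mono)
    then show "{xs \<in> space M. \<not> f xs \<ge> (LINT xs|M. f xs) + t}
        \<subseteq> {xs \<in> space M. f xs \<le> 2 * R / sqrt p * (1 + sqrt (\<alpha> / 2))}"
      using Ef by (auto simp: t_def distrib_left)
  qed auto
  finally show ?thesis .
qed

section \<open>Orthogonal projections and top eigenspaces\<close>

definition orthonormal_upto :: "nat \<Rightarrow> (nat \<Rightarrow> 'h::real_inner) \<Rightarrow> bool" where
  "orthonormal_upto m e \<longleftrightarrow> (\<forall>i<m. \<forall>j<m. e i \<bullet> e j = (if i = j then 1 else 0))"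

definition proj_upto :: "nat \<Rightarrow> (nat \<Rightarrow> 'h::real_inner) \<Rightarrow> 'h \<Rightarrow> 'h" where
  "proj_upto m e v = (\<Sum>k<m. (v \<bullet> e k) *\<^sub>R e k)"

lemma orthonormal_uptoD:
  assumes "orthonormal_upto m e" "i < m" "j < m"
  shows "e i \<bullet> e j = (if i = j then 1 else 0)"
  using assms by (simp add: orthonormal_upto_def)

lemma proj_upto_symmetric: "proj_upto m e u \<bullet> v = u \<bullet> proj_upto m e v"
  by (simp add: proj_upto_def inner_sum_left inner_sum_right inner_commute mult.commute)

lemma linear_proj_upto: "linear (proj_upto m e)"
  by (rule linearI)
    (simp_all add: proj_upto_def inner_add_left scaleR_add_left sum.distrib scaleR_sum_right)

lemma proj_upto_inner:
  assumes "orthonormal_upto m e" "k < m"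
  shows "proj_upto m e v \<bullet> e k = v \<bullet> e k"
  unfolding proj_upto_def using assms
  by (intro inner_sum_scaleR_orthonormal) (auto simp: orthonormal_uptoD)

lemma proj_upto_idem:
  assumes "orthonormal_upto m e"
  shows "proj_upto m e (proj_upto m e v) = proj_upto m e v"
proof -
  have "(\<Sum>k<m. (proj_upto m e v \<bullet> e k) *\<^sub>R e k) = (\<Sum>k<m. (v \<bullet> e k) *\<^sub>R e k)"
    by (intro sum.cong refl) (simp add: proj_upto_inner[OF assms])
  then show ?thesis unfolding proj_upto_def[symmetric] .
qed

lemma proj_upto_residual_orth:
  assumes "orthonormal_upto m e"
  shows "(v - proj_upto m e v) \<bullet> proj_upto m e u = 0"
  using proj_upto_symmetric[of m e "v - proj_upto m e v" u]
  by (simp add: linear_diff[OF linear_proj_upto] proj_upto_idem[OF assms])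

lemma norm_residual_proj_upto:
  assumes "orthonormal_upto m e"
  shows "(norm (v - proj_upto m e v))\<^sup>2 = (norm v)\<^sup>2 - (\<Sum>k<m. (v \<bullet> e k)\<^sup>2)"
proof -
  have "(norm (v - proj_upto m e v))\<^sup>2 = (v - proj_upto m e v) \<bullet> v"
    using proj_upto_residual_orth[OF assms, of v v] by (simp add: power2_norm_eq_inner inner_diff_right)
  moreover have "proj_upto m e v \<bullet> v = (\<Sum>k<m. (v \<bullet> e k)\<^sup>2)"
    unfolding proj_upto_def inner_sum_left inner_scaleR_left inner_commute[of "e _" v]
    by (simp only: power2_eq_square)
  ultimately show ?thesis by (simp add: inner_diff_left power2_norm_eq_inner)
qed

lemma norm_proj_upto_le:
  assumes "orthonormal_upto m e"
  shows "norm (proj_upto m e v) \<le> norm v"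
proof -
  have "(norm (proj_upto m e v))\<^sup>2 = proj_upto m e v \<bullet> v"
    by (metis assms power2_norm_eq_inner proj_upto_idem proj_upto_symmetric inner_commute)
  also have "\<dots> \<le> norm (proj_upto m e v) * norm v" by (rule norm_cauchy_schwarz)
  finally show ?thesis
    by (cases "proj_upto m e v = 0") (auto simp: power2_eq_square)
qed

lemma orth_proj_span:
  assumes on: "orthonormal_upto m e"
  shows "orth_proj (span (e ` {..<m})) v = proj_upto m e v"
  unfolding orth_proj_def
proof (rule the_equality)
  have S: "proj_upto m e v \<in> span (e ` {..<m})"
    unfolding proj_upto_def by (intro span_sum span_scale span_base) auto
  have orth: "(v - proj_upto m e v) \<bullet> u = 0" if "u \<in> span (e ` {..<m})" for u
    using that
  proof (induction rule: span_induct)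
    case base
    show ?case
      by (auto simp: subspace_def inner_add_right)
  next
    case (step x)
    then show ?case using proj_upto_inner[OF on] by (auto simp: inner_diff_left)
  qed
  show "proj_upto m e v \<in> span (e ` {..<m}) \<and> (\<forall>u\<in>span (e ` {..<m}). (v - proj_upto m e v) \<bullet> u = 0)"
    using S orth by blast
  fix w assume w: "w \<in> span (e ` {..<m}) \<and> (\<forall>u\<in>span (e ` {..<m}). (v - w) \<bullet> u = 0)"
  have d: "w - proj_upto m e v \<in> span (e ` {..<m})" using w S by (intro span_diff) auto
  have "(v - w) \<bullet> (w - proj_upto m e v) = 0" using w d by blast
  moreover have "(v - proj_upto m e v) \<bullet> (w - proj_upto m e v) = 0" using orth[OF d] .
  ultimately have "(w - proj_upto m e v) \<bullet> (w - proj_upto m e v) = 0"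
    by (simp add: inner_diff_left)
  then show "w = proj_upto m e v" by simp
qed

lemma norm_sum_scaleR_le:
  fixes r :: "'i \<Rightarrow> 'h::real_normed_vector"
  shows "(norm (\<Sum>j\<in>I. c j *\<^sub>R r j))\<^sup>2 \<le> (\<Sum>j\<in>I. (c j)\<^sup>2) * (\<Sum>j\<in>I. (norm (r j))\<^sup>2)"
proof -
  have "norm (\<Sum>j\<in>I. c j *\<^sub>R r j) \<le> (\<Sum>j\<in>I. \<bar>c j\<bar> * norm (r j))"
    by (rule order_trans[OF norm_sum]) simp
  then have "(norm (\<Sum>j\<in>I. c j *\<^sub>R r j))\<^sup>2 \<le> (\<Sum>j\<in>I. \<bar>c j\<bar> * norm (r j))\<^sup>2"
    by (rule power_mono) simp
  also have "\<dots> \<le> (\<Sum>j\<in>I. \<bar>c j\<bar>\<^sup>2) * (\<Sum>j\<in>I. (norm (r j))\<^sup>2)"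
    by (rule Cauchy_Schwarz_ineq_sum)
  finally show ?thesis by simp
qed

lemma bessel_upto:
  assumes "orthonormal_upto m e"
  shows "(\<Sum>k<m. (v \<bullet> e k)\<^sup>2) \<le> (norm v)\<^sup>2"
  using norm_residual_proj_upto[OF assms, of v] zero_le_power2[of "norm (v - proj_upto m e v)"]
  by linarith

lemma sample_cov_inner:
  "u \<bullet> sample_cov \<Phi> p xs v = (\<Sum>i<p. (\<Phi> (xs i) \<bullet> u) * (\<Phi> (xs i) \<bullet> v)) / real p"
  unfolding sample_cov_def inner_scaleR_right inner_sum_right
  by (simp add: inner_commute mult.commute)

text \<open>Ky Fan's maximum principle. The definition of a top eigenspace restricts only the
  eigenvectors orthogonal to \<open>e\<close>, while a bound on the whole quadratic form over the
  orthogonal complement is required. It holds because a violation would produce an eigenvector there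
  with too large an eigenvalue.\<close>

lemma top_eigenspace_trace_maximal:
  fixes \<Phi> :: "'a \<Rightarrow> 'h::real_inner"
  assumes top: "top_eigenspace (sample_cov \<Phi> p xs) m S" and m: "m \<ge> 1" and p: "p > 0"
  obtains e where "orthonormal_upto m e" "S = span (e ` {..<m})"
    "\<And>u. orthonormal_upto m u \<Longrightarrow>
       (\<Sum>j<m. \<Sum>i<p. (\<Phi> (xs i) \<bullet> u j)\<^sup>2) \<le> (\<Sum>j<m. \<Sum>i<p. (\<Phi> (xs i) \<bullet> e j)\<^sup>2)"
proof -
  let ?C = "sample_cov \<Phi> p xs"
  from top[unfolded top_eigenspace_def, folded orthonormal_upto_def]
  obtain e lam where *: "orthonormal_upto m e \<and> (\<forall>i<m. ?C (e i) = lam i *\<^sub>R e i) \<and>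
      (\<forall>i j. i \<le> j \<longrightarrow> j < m \<longrightarrow> lam j \<le> lam i) \<and>
      (\<forall>v c. v \<noteq> 0 \<longrightarrow> (\<forall>i<m. v \<bullet> e i = 0) \<longrightarrow> ?C v = c *\<^sub>R v \<longrightarrow> c \<le> lam (m - 1)) \<and>
      S = span (e ` {..<m})"
    by (elim exE)
  then have on: "orthonormal_upto m e" and eig: "\<And>i. i < m \<Longrightarrow> ?C (e i) = lam i *\<^sub>R e i"
    and mono: "\<And>i j. i \<le> j \<Longrightarrow> j < m \<Longrightarrow> lam j \<le> lam i"
    and top: "\<And>v c. v \<noteq> 0 \<Longrightarrow> (\<And>i. i < m \<Longrightarrow> v \<bullet> e i = 0) \<Longrightarrow> ?C v = c *\<^sub>R v \<Longrightarrow> c \<le> lam (m - 1)"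
    and S: "S = span (e ` {..<m})"
    by blast+
  define q where "q v = v \<bullet> ?C v" for v
  have q: "q v = (\<Sum>i<p. (\<Phi> (xs i) \<bullet> v)\<^sup>2) / p" for v
    unfolding q_def sample_cov_inner by (simp add: power2_eq_square)
  have qe: "q (e i) = lam i" if "i < m" for i
    using that on by (simp add: q_def eig orthonormal_uptoD)
  have lam0: "0 \<le> lam (m - 1)"
  proof -
    have "0 \<le> q (e (m - 1))" by (simp add: q sum_nonneg)
    then show ?thesis using qe[of "m - 1"] m by simp
  qed
  \<comment> \<open>Deflation: \<open>T\<close> is \<open>p\<close> times the compression of the
    sample covariance to the orthogonal complement of \<open>e\<close>, and is again a sum of rank
    one terms, as \<open>finite_rank_top_eigenvector\<close> requires.\<close>
  define w where "w i = \<Phi> (xs i) - proj_upto m e (\<Phi> (xs i))" for i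
  define T where "T v = (\<Sum>i<p. (w i \<bullet> v) *\<^sub>R w i)" for v
  have w_orth: "w i \<bullet> e k = 0" if "k < m" for i k
    using proj_upto_inner[OF on that] by (simp add: w_def inner_diff_left)
  have qT: "v \<bullet> T v \<le> real p * lam (m - 1) * (v \<bullet> v)" for v
  proof (rule ccontr)
    assume "\<not> ?thesis"
    then have gt: "v \<bullet> T v > real p * lam (m - 1) * (v \<bullet> v)" by simp
    obtain \<beta> z where z: "\<beta> > real p * lam (m - 1)" "z \<noteq> 0" "T z = \<beta> *\<^sub>R z"
      using finite_rank_top_eigenvector[of "real p * lam (m - 1)" v w p] gt lam0 unfolding T_def by auto
    have b0: "\<beta> > 0" using z(1) mult_nonneg_nonneg[OF of_nat_0_le_iff[of p] lam0] by linarith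
    \<comment> \<open>The range of \<open>T\<close> is orthogonal to \<open>e\<close>, and \<beta> >
      0 transfers this to \<open>z\<close>. Hence \<open>z\<close> is an eigenvector of the sample
      covariance itself, with eigenvalue \<open>\<beta> / p\<close>.\<close>
    have zorth: "z \<bullet> e k = 0" if "k < m" for k
    proof -
      have "T z \<bullet> e k = 0" by (simp add: T_def inner_sum_left w_orth[OF that])
      then show ?thesis using z(3) b0 by simp
    qed
    have pz: "proj_upto m e z = 0" by (simp add: proj_upto_def zorth)
    have wz: "\<Phi> (xs i) \<bullet> z = w i \<bullet> z" for i
      unfolding w_def using proj_upto_symmetric[of m e "\<Phi> (xs i)" z] pz by (simp add: inner_diff_left)
    have "?C z \<bullet> e k = 0" if "k < m" for k
    proof -
      have "?C z \<bullet> e k = z \<bullet> ?C (e k)"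
        by (subst inner_commute) (simp add: sample_cov_inner mult.commute)
      then show ?thesis using that by (simp add: eig zorth)
    qed
    then have "proj_upto m e (?C z) = 0" by (simp add: proj_upto_def)
    moreover have "?C z = (1 / p) *\<^sub>R (\<Sum>i<p. (w i \<bullet> z) *\<^sub>R \<Phi> (xs i))"
      by (simp add: sample_cov_def wz)
    then have "?C z - proj_upto m e (?C z) = (1 / p) *\<^sub>R T z"
      by (simp add: linear_sum[OF linear_proj_upto] linear_scale[OF linear_proj_upto] T_def w_def
          scaleR_diff_right sum_subtractf)
    ultimately have "?C z = (\<beta> / p) *\<^sub>R z" using z(3) by simp
    then have "\<beta> / p \<le> lam (m - 1)" using top[of z "\<beta> / p"] z(2) zorth by blast
    then show False using z(1) p by (simp add: field_simps)
  qed
  \<comment> \<open>The form is diagonal on the span of \<open>e\<close> and at most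
    \<open>lam (m - 1)\<close> times the squared norm on the complement; the cross term vanishes
    because the span is invariant under a symmetric operator.\<close>
  have main: "q v \<le> lam (m - 1) * (norm v)\<^sup>2 + (\<Sum>k<m. (lam k - lam (m - 1)) * (v \<bullet> e k)\<^sup>2)" for v
  proof -
    define a where "a = proj_upto m e v"
    define b where "b = v - a"
    have v: "v = a + b" by (simp add: b_def)
    have Ca: "?C a = (\<Sum>k<m. (v \<bullet> e k) *\<^sub>R lam k *\<^sub>R e k)"
    proof -
      have lin: "linear ?C"
        by (rule linearI) (simp_all add: sample_cov_def inner_add_right scaleR_add_left sum.distrib
            scaleR_add_right scaleR_sum_right mult.left_commute)
      show ?thesis
        unfolding a_def proj_upto_def linear_sum[OF lin]
        by (intro sum.cong refl) (simp add: linear_scale[OF lin] eig)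
    qed
    have be: "b \<bullet> e k = 0" if "k < m" for k
      using proj_upto_inner[OF on that] by (simp add: a_def b_def inner_diff_left)
    have bCa: "b \<bullet> ?C a = 0"
      unfolding Ca by (simp add: inner_sum_right be)
    then have "a \<bullet> ?C b = 0" by (simp add: sample_cov_inner mult.commute)
    moreover have Cadd: "?C v = ?C a + ?C b"
      by (simp add: v sample_cov_def inner_add_right scaleR_add_left sum.distrib scaleR_add_right)
    ultimately have "q v = a \<bullet> ?C a + b \<bullet> ?C b"
      using bCa unfolding q_def Cadd by (simp add: v inner_add_left inner_add_right)
    also have "a \<bullet> ?C a = v \<bullet> ?C a" using bCa by (simp add: v inner_add_left)
    also have "\<dots> = (\<Sum>k<m. lam k * (v \<bullet> e k)\<^sup>2)"
      unfolding Ca by (simp add: inner_sum_right power2_eq_square mult_ac)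
    also have "b \<bullet> ?C b \<le> lam (m - 1) * (norm b)\<^sup>2"
    proof -
      have "proj_upto m e b = 0" by (simp add: proj_upto_def be)
      then have "\<Phi> (xs i) \<bullet> b = w i \<bullet> b" for i
        unfolding w_def using proj_upto_symmetric[of m e "\<Phi> (xs i)" b] by (simp add: inner_diff_left)
      then have "b \<bullet> ?C b = (b \<bullet> T b) / p"
        by (simp add: sample_cov_inner T_def inner_sum_right inner_commute)
      also have "\<dots> \<le> real p * lam (m - 1) * (b \<bullet> b) / p"
        by (intro divide_right_mono qT) auto
      finally show ?thesis using p by (simp add: dot_square_norm)
    qed
    also have "(norm b)\<^sup>2 = (norm v)\<^sup>2 - (\<Sum>k<m. (v \<bullet> e k)\<^sup>2)"
      unfolding b_def a_def by (rule norm_residual_proj_upto[OF on])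
    finally show ?thesis
      by (simp add: algebra_simps sum_subtractf sum_distrib_left)
  qed
  have "(\<Sum>j<m. \<Sum>i<p. (\<Phi> (xs i) \<bullet> u j)\<^sup>2) \<le> (\<Sum>j<m. \<Sum>i<p. (\<Phi> (xs i) \<bullet> e j)\<^sup>2)"
    if u: "orthonormal_upto m u" for u
  proof -
    have nu: "(norm (u j))\<^sup>2 = 1" if "j < m" for j
      using u that by (simp add: power2_norm_eq_inner orthonormal_uptoD)
    have ne: "(norm (e j))\<^sup>2 = 1" if "j < m" for j
      using on that by (simp add: power2_norm_eq_inner orthonormal_uptoD)
    \<comment> \<open>Once \<open>lam (m - 1)\<close> is split off, all remaining coefficients are
      nonnegative, so Bessel's upper bound on the weights suffices.\<close>
    have "(\<Sum>j<m. q (u j)) \<le> (\<Sum>j<m. lam (m - 1) + (\<Sum>k<m. (lam k - lam (m - 1)) * (u j \<bullet> e k)\<^sup>2))"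
      by (intro sum_mono order_trans[OF main]) (simp add: nu)
    also have "\<dots> = m * lam (m - 1) + (\<Sum>k<m. (lam k - lam (m - 1)) * (\<Sum>j<m. (e k \<bullet> u j)\<^sup>2))"
      by (subst sum.distrib, subst sum.swap) (simp add: sum_distrib_left inner_commute)
    also have "\<dots> \<le> m * lam (m - 1) + (\<Sum>k<m. (lam k - lam (m - 1)) * 1)"
    proof (intro add_left_mono sum_mono mult_left_mono)
      fix k assume "k \<in> {..<m}"
      then show "(\<Sum>j<m. (e k \<bullet> u j)\<^sup>2) \<le> 1" "0 \<le> lam k - lam (m - 1)"
        using bessel_upto[OF u, of "e k"] ne[of k] mono[of k "m - 1"] m by auto
    qed
    also have "\<dots> = (\<Sum>j<m. q (e j))" by (simp add: sum_subtractf qe)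
    finally show ?thesis using p by (simp add: q sum_divide_distrib[symmetric] divide_le_cancel)
  qed
  then show ?thesis using that on S by blast
qed

section \<open>The spectrum of a feature map\<close>

text \<open>Only scalar measurability is required, so no sigma-algebra on the feature space enters.
  The locale serves both for the features and for their projections onto a sample
  eigenspace.\<close>

locale bounded_feature_map = prob_space P for P :: "'a measure" +
  fixes \<Phi> :: "'a \<Rightarrow> 'h::real_inner" and G :: real
  assumes feature_measurable [measurable]: "\<And>h. (\<lambda>x. \<Phi> x \<bullet> h) \<in> borel_measurable P"
    and feature_bound: "\<And>x. norm (\<Phi> x) \<le> G"
begin

lemma G_nonneg: "0 \<le> G"
  using feature_bound norm_ge_zero order_trans by blast

lemma feature_inner_bound: "\<bar>\<Phi> x \<bullet> h\<bar> \<le> G * norm h"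
  by (rule order_trans[OF Cauchy_Schwarz_ineq2]) (intro mult_right_mono feature_bound norm_ge_zero)

lemma integrable_feature_prod: "integrable P (\<lambda>x. (\<Phi> x \<bullet> g) * (\<Phi> x \<bullet> h))"
  by (rule integrable_const_bound[of _ "(G * norm g) * (G * norm h)"])
    (auto simp: abs_mult intro!: mult_mono feature_inner_bound mult_nonneg_nonneg G_nonneg)

lemma integrable_feature_sq: "integrable P (\<lambda>x. (\<Phi> x \<bullet> h)\<^sup>2)"
  using integrable_feature_prod[of h h] by (simp add: power2_eq_square)

end

text \<open>The eigensystem \<open>(\<mu>, e)\<close> of the population covariance, in weak form; eigenvectors of
  eigenvalue 0 are padded by 0. The assumption on norms says that \<open>\<Phi> x\<close> lies in the closed span
  of the eigenvectors.\<close>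
locale feature_spectrum = bounded_feature_map P \<Phi> G
  for P :: "'a measure" and \<Phi> :: "'a \<Rightarrow> 'h::real_inner" and G :: real +
  fixes \<mu> :: "nat \<Rightarrow> real" and e :: "nat \<Rightarrow> 'h"
  assumes eigenvalue_nonneg: "\<And>j. 0 \<le> \<mu> j"
    and eigenvalue_antimono: "\<And>i j. i \<le> j \<Longrightarrow> \<mu> j \<le> \<mu> i"
    and eigenvector_orth: "\<And>i j. e i \<bullet> e j = (if i = j \<and> 0 < \<mu> i then 1 else 0)"
    and covariance: "\<And>h j. (LINT x|P. (\<Phi> x \<bullet> h) * (\<Phi> x \<bullet> e j)) = \<mu> j * (h \<bullet> e j)"
    and complete: "\<And>x. (\<lambda>j. (\<Phi> x \<bullet> e j)\<^sup>2) sums (norm (\<Phi> x))\<^sup>2"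
begin

lemma eigenvector_zero: "\<mu> j = 0 \<Longrightarrow> e j = 0"
  using eigenvector_orth[of j j] by simp

lemma eigenvector_norm_le: "norm (e j) \<le> 1"
  using eigenvector_orth[of j j] by (auto simp: norm_eq_sqrt_inner)

lemma eigenvectors_bessel: "finite I \<Longrightarrow> (\<Sum>j\<in>I. (h \<bullet> e j)\<^sup>2) \<le> (norm h)\<^sup>2"
  by (rule bessel) (auto simp: eigenvector_orth eigenvector_norm_le)

lemma orthonormal_upto_eigenvectors: "(\<And>j. j < m \<Longrightarrow> 0 < \<mu> j) \<Longrightarrow> orthonormal_upto m e"
  by (simp add: orthonormal_upto_def eigenvector_orth)

definition trunc :: "nat \<Rightarrow> 'a \<Rightarrow> 'h" where
  "trunc N x = (\<Sum>j<N. (\<Phi> x \<bullet> e j) *\<^sub>R e j)"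

lemma trunc_inner: "trunc N x \<bullet> h = (\<Sum>j<N. (\<Phi> x \<bullet> e j) * (h \<bullet> e j))"
  unfolding trunc_def inner_sum_left inner_scaleR_left by (simp add: inner_commute)

lemma norm_trunc: "(norm (trunc N x))\<^sup>2 = (\<Sum>j<N. (\<Phi> x \<bullet> e j)\<^sup>2)"
  unfolding trunc_def
  by (subst norm_sum_scaleR_orthogonal)
    (auto simp: eigenvector_orth power2_norm_eq_inner intro!: sum.cong
      dest!: order.antisym[OF eigenvalue_nonneg leI] eigenvector_zero[OF sym])

lemma norm_trunc_le: "norm (trunc N x) \<le> G"
proof -
  have "(norm (trunc N x))\<^sup>2 \<le> (norm (\<Phi> x))\<^sup>2"
    unfolding norm_trunc by (rule eigenvectors_bessel) simp
  then show ?thesis using feature_bound[of x] by (meson norm_ge_zero order_trans power2_le_imp_le)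
qed

lemma norm_trunc_residual: "(norm (\<Phi> x - trunc N x))\<^sup>2 = (norm (\<Phi> x))\<^sup>2 - (\<Sum>j<N. (\<Phi> x \<bullet> e j)\<^sup>2)"
proof -
  have "\<Phi> x \<bullet> trunc N x = (norm (trunc N x))\<^sup>2"
    unfolding norm_trunc by (simp add: inner_commute[of "\<Phi> x"] trunc_inner power2_eq_square)
  then show ?thesis
    unfolding norm_trunc[symmetric] unfolding power2_norm_eq_inner
    by (simp add: inner_diff inner_commute)
qed

lemma trunc_tendsto: "(\<lambda>N. trunc N x) \<longlonglongrightarrow> \<Phi> x"
proof -
  have "(\<lambda>N. (norm (\<Phi> x))\<^sup>2 - (\<Sum>j<N. (\<Phi> x \<bullet> e j)\<^sup>2)) \<longlonglongrightarrow> (norm (\<Phi> x))\<^sup>2 - (norm (\<Phi> x))\<^sup>2"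
    using complete[of x] unfolding sums_def by (intro tendsto_intros)
  then have "(\<lambda>N. (norm (\<Phi> x - trunc N x))\<^sup>2) \<longlonglongrightarrow> 0"
    by (simp add: norm_trunc_residual)
  from tendsto_real_sqrt[OF this] have "(\<lambda>N. \<Phi> x - trunc N x) \<longlonglongrightarrow> 0"
    by (simp add: tendsto_norm_zero_iff)
  from tendsto_diff[OF tendsto_const[of "\<Phi> x"] this] show ?thesis by simp
qed

lemma trunc_measurable [measurable]: "(\<lambda>x. trunc N x \<bullet> h) \<in> borel_measurable P"
  unfolding trunc_inner by measurable

lemma trunc_inner_bound: "\<bar>trunc N x \<bullet> h\<bar> \<le> G * norm h"
  by (rule order_trans[OF Cauchy_Schwarz_ineq2]) (intro mult_right_mono norm_trunc_le norm_ge_zero)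

text \<open>The diagonal form of \<Sigma>. Only one of the two factors is truncated, so that the
  weak eigenvalue equation \<open>covariance\<close> evaluates each term; dominated convergence
  removes the truncation.\<close>

lemma variance_sums: "(\<lambda>j. \<mu> j * (h \<bullet> e j)\<^sup>2) sums (LINT x|P. (\<Phi> x \<bullet> h)\<^sup>2)"
proof -
  have "(\<lambda>N. LINT x|P. (\<Phi> x \<bullet> h) * (trunc N x \<bullet> h)) \<longlonglongrightarrow> (LINT x|P. (\<Phi> x \<bullet> h) * (\<Phi> x \<bullet> h))"
  proof (rule integral_dominated_convergence[where w = "\<lambda>_. (G * norm h) * (G * norm h)"])
    show "AE x in P. (\<lambda>N. (\<Phi> x \<bullet> h) * (trunc N x \<bullet> h)) \<longlonglongrightarrow> (\<Phi> x \<bullet> h) * (\<Phi> x \<bullet> h)"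
      by (intro AE_I2 tendsto_intros trunc_tendsto)
    show "AE x in P. norm ((\<Phi> x \<bullet> h) * (trunc N x \<bullet> h)) \<le> (G * norm h) * (G * norm h)" for N
      by (intro AE_I2) (auto simp: abs_mult intro!: mult_mono feature_inner_bound trunc_inner_bound
          mult_nonneg_nonneg G_nonneg)
  qed auto
  moreover have "(LINT x|P. (\<Phi> x \<bullet> h) * (trunc N x \<bullet> h)) = (\<Sum>j<N. \<mu> j * (h \<bullet> e j)\<^sup>2)" for N
  proof -
    have "(LINT x|P. (\<Phi> x \<bullet> h) * (trunc N x \<bullet> h))
        = (LINT x|P. (\<Sum>j<N. (\<Phi> x \<bullet> h) * (\<Phi> x \<bullet> e j) * (h \<bullet> e j)))"
      by (simp add: trunc_inner sum_distrib_left mult.assoc)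
    also have "\<dots> = (\<Sum>j<N. (LINT x|P. (\<Phi> x \<bullet> h) * (\<Phi> x \<bullet> e j)) * (h \<bullet> e j))"
      by (subst Bochner_Integration.integral_sum) (auto intro!: integrable_feature_prod)
    finally show ?thesis by (simp add: covariance power2_eq_square mult.assoc)
  qed
  ultimately show ?thesis by (simp add: sums_def power2_eq_square)
qed

lemma variance_eigenvector: "(LINT x|P. (\<Phi> x \<bullet> e j)\<^sup>2) = \<mu> j"
  using covariance[of "e j" j] eigenvector_orth[of j j] eigenvalue_nonneg[of j]
  by (auto simp: power2_eq_square)

text \<open>The partial sums of the trace of \<Sigma> are the mean squared norms of the truncated
  features.\<close>

lemma sum_eigenvalues_le: "(\<Sum>j<N. \<mu> j) \<le> G\<^sup>2"
proof -
  have "(\<Sum>j<N. \<mu> j) = (LINT x|P. (\<Sum>j<N. (\<Phi> x \<bullet> e j)\<^sup>2))"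
    by (subst Bochner_Integration.integral_sum) (auto simp: variance_eigenvector integrable_feature_sq)
  also have "\<dots> \<le> (LINT x|P. G\<^sup>2)"
  proof (rule integral_mono)
    show "(\<Sum>j<N. (\<Phi> x \<bullet> e j)\<^sup>2) \<le> G\<^sup>2" for x
      unfolding norm_trunc[symmetric] by (intro power_mono norm_trunc_le norm_ge_zero)
  qed (auto intro!: Bochner_Integration.integrable_sum integrable_feature_sq)
  finally show ?thesis by (simp add: prob_space)
qed

lemma eigenvalue_le: "\<mu> j \<le> G\<^sup>2"
proof -
  have "\<mu> j \<le> (\<Sum>i<Suc j. \<mu> i)" by (simp add: sum_nonneg eigenvalue_nonneg)
  also have "\<dots> \<le> G\<^sup>2" by (rule sum_eigenvalues_le)
  finally show ?thesis .
qed

lemma summable_eigenvalues: "summable \<mu>"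
proof (rule summableI_nonneg_bounded)
  show "(\<Sum>j<N. \<mu> j) \<le> G\<^sup>2" for N by (rule sum_eigenvalues_le)
qed (rule eigenvalue_nonneg)

text \<open>Upper half of the min-max principle: only eigenvalues from \<open>\<mu> i\<close> on
  contribute, with total weight bounded by Bessel.\<close>

lemma variance_le_of_orth:
  assumes "\<And>j. j < i \<Longrightarrow> h \<bullet> e j = 0"
  shows "(LINT x|P. (\<Phi> x \<bullet> h)\<^sup>2) \<le> \<mu> i * (norm h)\<^sup>2"
proof (rule LIMSEQ_le_const2[OF variance_sums[unfolded sums_def]], intro exI allI impI)
  fix N :: nat
  have "(\<Sum>j<N. \<mu> j * (h \<bullet> e j)\<^sup>2) \<le> (\<Sum>j<N. \<mu> i * (h \<bullet> e j)\<^sup>2)"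
  proof (rule sum_mono)
    fix j
    show "\<mu> j * (h \<bullet> e j)\<^sup>2 \<le> \<mu> i * (h \<bullet> e j)\<^sup>2"
      using assms[of j] eigenvalue_antimono[of i j] by (cases "j < i") (auto intro: mult_right_mono)
  qed
  also have "\<dots> = \<mu> i * (\<Sum>j<N. (h \<bullet> e j)\<^sup>2)" by (simp add: sum_distrib_left)
  also have "\<dots> \<le> \<mu> i * (norm h)\<^sup>2"
    by (intro mult_left_mono eigenvectors_bessel eigenvalue_nonneg) simp
  finally show "(\<Sum>j<N. \<mu> j * (h \<bullet> e j)\<^sup>2) \<le> \<mu> i * (norm h)\<^sup>2" .
qed

text \<open>Lower half of the min-max principle. Positivity of \<open>\<mu> i\<close> ensures that
  no eigenvector up to index \<open>i\<close> is padding.\<close>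

lemma variance_ge_on_span:
  assumes "0 < \<mu> i" and h: "h = (\<Sum>j\<le>i. c j *\<^sub>R e j)"
  shows "\<mu> i * (norm h)\<^sup>2 \<le> (LINT x|P. (\<Phi> x \<bullet> h)\<^sup>2)"
proof -
  have pos: "0 < \<mu> j" if "j \<le> i" for j
    using eigenvalue_antimono[OF that] assms(1) by simp
  have coef: "h \<bullet> e j = c j" if "j \<le> i" for j
    unfolding h using that pos by (intro inner_sum_scaleR_orthonormal) (auto simp: eigenvector_orth)
  have "(norm h)\<^sup>2 = (\<Sum>j\<le>i. (c j)\<^sup>2)"
    unfolding h using pos
    by (subst norm_sum_scaleR_orthogonal) (auto simp: eigenvector_orth power2_norm_eq_inner)
  then have "\<mu> i * (norm h)\<^sup>2 = (\<Sum>j<Suc i. \<mu> i * (h \<bullet> e j)\<^sup>2)"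
    by (simp add: lessThan_Suc_atMost sum_distrib_left coef)
  also have "\<dots> \<le> (\<Sum>j<Suc i. \<mu> j * (h \<bullet> e j)\<^sup>2)"
    by (intro sum_mono mult_right_mono eigenvalue_antimono) auto
  also have "\<dots> \<le> (LINT x|P. (\<Phi> x \<bullet> h)\<^sup>2)"
    using variance_sums[of h]
    by (subst sums_unique[OF variance_sums]) (intro sum_le_suminf, auto simp: sums_iff eigenvalue_nonneg)
  finally show ?thesis .
qed

text \<open>The vector on which both halves of the min-max principle can be tested; \<open>w\<close>
  will be the eigenvectors of the other covariance.\<close>

lemma eigenspan_meets_orthogonal:
  assumes "0 < \<mu> i"
  obtains c h where "h = (\<Sum>j\<le>i. c j *\<^sub>R e j)" "norm h = 1" "\<And>j. j < i \<Longrightarrow> h \<bullet> w j = 0"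
proof -
  have pos: "0 < \<mu> j" if "j \<le> i" for j
    using eigenvalue_antimono[OF that] assms by simp
  obtain c where c: "\<exists>k\<le>i. c k \<noteq> 0" "\<And>j. j < i \<Longrightarrow> (\<Sum>k\<le>i. c k * (e k \<bullet> w j)) = 0"
    using homogeneous_system_nontrivial_solution[of "{..<i}" "{..i}" "\<lambda>j k. e k \<bullet> w j"] by auto
  define g where "g = (\<Sum>j\<le>i. c j *\<^sub>R e j)"
  have gw: "g \<bullet> w j = 0" if "j < i" for j
    using c(2)[OF that] by (simp add: g_def inner_sum_left)
  have "g \<noteq> 0"
  proof
    assume "g = 0"
    obtain k where k: "k \<le> i" "c k \<noteq> 0" using c(1) by blast
    have "g \<bullet> e k = c k"
      unfolding g_def using k pos by (intro inner_sum_scaleR_orthonormal) (auto simp: eigenvector_orth)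
    then show False using \<open>g = 0\<close> k by simp
  qed
  show ?thesis
  proof (rule that[of "g /\<^sub>R norm g" "\<lambda>j. inverse (norm g) * c j"])
    show "g /\<^sub>R norm g = (\<Sum>j\<le>i. (inverse (norm g) * c j) *\<^sub>R e j)"
      by (simp add: g_def scaleR_sum_right)
  qed (use \<open>g \<noteq> 0\<close> gw in auto)
qed

end

section \<open>Mercer systems and deviation of the covariance\<close>

text \<open>The eigenvector is the weak integral of \<open>\<psi> j\<close> times \<Phi>, supplied
  by Riesz and normalized. Applied to \<open>K\<close> and to the proxy kernel, this turns both
  Mercer systems into orthonormal systems in one space, where they can be compared.\<close>

lemma mercer_feature_spectrum:
  fixes \<Phi> :: "'a::topological_space \<Rightarrow> 'h::{real_inner, complete_space}"
  assumes "bounded_feature_map P \<Phi> G"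
    and A: "AE x in P. x \<in> A" and outside: "\<And>x. x \<notin> A \<Longrightarrow> \<Phi> x = 0"
    and K: "\<And>x y. x \<in> A \<Longrightarrow> y \<in> A \<Longrightarrow> K x y = \<Phi> x \<bullet> \<Phi> y"
    and mercer: "mercer_system P A K \<nu> \<psi>"
  obtains e where "feature_spectrum P \<Phi> G \<nu> e"
    "\<And>j x. x \<in> A \<Longrightarrow> \<Phi> x \<bullet> e j = sqrt (\<nu> j) * \<psi> j x"
proof -
  interpret bounded_feature_map P \<Phi> G by fact
  have nn: "0 \<le> \<nu> j" for j using mercer by (simp add: mercer_system_def)
  have mono: "\<nu> j \<le> \<nu> i" if "i \<le> j" for i j using mercer that by (simp add: mercer_system_def)
  have meas [measurable]: "\<psi> j \<in> borel_measurable P" for j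
    using mercer by (simp add: mercer_system_def)
  have sq: "integrable P (\<lambda>x. (\<psi> j x)\<^sup>2)" if "0 < \<nu> j" for j
    using mercer that by (simp add: mercer_system_def)
  have orth: "(LINT x|P. \<psi> i x * \<psi> j x) = (if i = j then 1 else 0)" if "0 < \<nu> i" "0 < \<nu> j" for i j
    using mercer that by (simp add: mercer_system_def)
  have eig: "integrable P (\<lambda>y. K x y * \<psi> j y)" "(LINT y|P. K x y * \<psi> j y) = \<nu> j * \<psi> j x"
    if "0 < \<nu> j" "x \<in> A" for j x
    using mercer that by (simp_all add: mercer_system_def)
  have lim: "uniform_limit (A \<times> A) (\<lambda>n (u, v). \<Sum>j<n. \<nu> j * \<psi> j u * \<psi> j v) (\<lambda>(u, v). K u v) sequentially"
    using mercer by (simp add: mercer_system_def)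
  \<comment> \<open>On a probability space square integrability gives integrability, through |t| <=
    1 + t^2.\<close>
  have int\<psi>: "integrable P (\<psi> j)" if "0 < \<nu> j" for j
  proof (rule Bochner_Integration.integrable_bound[of _ "\<lambda>x. 1 + (\<psi> j x)\<^sup>2"])
    show "integrable P (\<lambda>x. 1 + (\<psi> j x)\<^sup>2)" using sq[OF that] by simp
    have "\<bar>t\<bar> \<le> 1 + t\<^sup>2" for t :: real
      using zero_le_power2[of "\<bar>t\<bar> - 1"] by (simp add: power2_diff)
    then show "AE x in P. norm (\<psi> j x) \<le> norm (1 + (\<psi> j x)\<^sup>2)"
      by (intro AE_I2) (simp add: abs_of_nonneg)
  qed simp
  have dom: "\<bar>(\<Phi> y \<bullet> h) * \<psi> j y\<bar> \<le> G * norm h * \<bar>\<psi> j y\<bar>" for y h j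
    unfolding abs_mult by (intro mult_right_mono feature_inner_bound) simp
  have int: "integrable P (\<lambda>y. (\<Phi> y \<bullet> h) * \<psi> j y)" if "0 < \<nu> j" for h j
  proof (rule Bochner_Integration.integrable_bound[of _ "\<lambda>y. G * norm h * \<psi> j y"])
    show "integrable P (\<lambda>y. G * norm h * \<psi> j y)" using int\<psi>[OF that] by simp
    show "AE y in P. norm ((\<Phi> y \<bullet> h) * \<psi> j y) \<le> norm (G * norm h * \<psi> j y)"
      using dom[of _ h j] G_nonneg by (intro AE_I2) (simp only: real_norm_def abs_mult abs_norm_cancel abs_of_nonneg)
  qed simp
  have "\<exists>g. \<forall>h. (LINT y|P. (\<Phi> y \<bullet> h) * \<psi> j y) = h \<bullet> g" if "0 < \<nu> j" for j
  proof -
    have "bounded_linear (\<lambda>h. LINT y|P. (\<Phi> y \<bullet> h) * \<psi> j y)"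
    proof (rule bounded_linear_intro[where K = "G * (LINT y|P. \<bar>\<psi> j y\<bar>)"])
      show "(LINT y|P. (\<Phi> y \<bullet> (g + h)) * \<psi> j y) = (LINT y|P. (\<Phi> y \<bullet> g) * \<psi> j y) + (LINT y|P. (\<Phi> y \<bullet> h) * \<psi> j y)"
        for g h using int[OF that] by (simp add: inner_add_right distrib_right)
      show "(LINT y|P. (\<Phi> y \<bullet> (r *\<^sub>R h)) * \<psi> j y) = r *\<^sub>R (LINT y|P. (\<Phi> y \<bullet> h) * \<psi> j y)" for r h
        by (simp add: mult.assoc)
      have "\<bar>LINT y|P. (\<Phi> y \<bullet> h) * \<psi> j y\<bar> \<le> (LINT y|P. G * norm h * \<bar>\<psi> j y\<bar>)" for h
        using dom int[OF that] int\<psi>[OF that]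
        by (intro order_trans[OF integral_abs_bound] integral_mono) auto
      then show "norm (LINT y|P. (\<Phi> y \<bullet> h) * \<psi> j y) \<le> norm h * (G * (LINT y|P. \<bar>\<psi> j y\<bar>))" for h
        by (simp add: mult_ac)
    qed
    then obtain g where "\<And>h. (LINT y|P. (\<Phi> y \<bullet> h) * \<psi> j y) = h \<bullet> g"
      using riesz_representation by blast
    then show ?thesis by blast
  qed
  then obtain g where g: "\<And>j h. 0 < \<nu> j \<Longrightarrow> (LINT y|P. (\<Phi> y \<bullet> h) * \<psi> j y) = h \<bullet> g j"
    by metis
  \<comment> \<open>The Riesz vector \<open>g j\<close> has squared norm \<open>\<nu> j\<close>,
    hence the factor.\<close>
  define e where "e j = (if 0 < \<nu> j then (1 / sqrt (\<nu> j)) *\<^sub>R g j else 0)" for j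
  have ev: "\<Phi> x \<bullet> e j = sqrt (\<nu> j) * \<psi> j x" if "x \<in> A" for j x
  proof (cases "0 < \<nu> j")
    case True
    have "\<Phi> x \<bullet> g j = (LINT y|P. (\<Phi> y \<bullet> \<Phi> x) * \<psi> j y)" using g[OF True] by simp
    also have "\<dots> = (LINT y|P. K x y * \<psi> j y)"
    proof (rule integral_cong_AE)
      show "(\<lambda>y. K x y * \<psi> j y) \<in> borel_measurable P"
        using eig(1)[OF True that] by (rule borel_measurable_integrable)
      show "AE y in P. (\<Phi> y \<bullet> \<Phi> x) * \<psi> j y = K x y * \<psi> j y"
        using A by eventually_elim (simp add: K that inner_commute)
    qed simp
    also have "\<dots> = \<nu> j * \<psi> j x" by (rule eig(2)[OF True that])
    finally have "\<Phi> x \<bullet> e j = \<nu> j / sqrt (\<nu> j) * \<psi> j x" using True by (simp add: e_def)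
    then show ?thesis using nn[of j] by (simp add: real_div_sqrt)
  next
    case False
    then have "\<nu> j = 0" using nn[of j] by simp
    then show ?thesis by (simp add: e_def)
  qed
  have cov: "(LINT x|P. (\<Phi> x \<bullet> h) * (\<Phi> x \<bullet> e j)) = \<nu> j * (h \<bullet> e j)" for h j
  proof (cases "0 < \<nu> j")
    case True
    have "(LINT x|P. (\<Phi> x \<bullet> h) * (\<Phi> x \<bullet> e j)) = (LINT x|P. sqrt (\<nu> j) * ((\<Phi> x \<bullet> h) * \<psi> j x))"
    proof (rule integral_cong_AE)
      show "AE x in P. (\<Phi> x \<bullet> h) * (\<Phi> x \<bullet> e j) = sqrt (\<nu> j) * ((\<Phi> x \<bullet> h) * \<psi> j x)"
        using A by eventually_elim (simp add: ev)
    qed auto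
    also have "\<dots> = sqrt (\<nu> j) * (h \<bullet> g j)" by (simp add: g[OF True])
    also have "\<dots> = \<nu> j * (h \<bullet> e j)" using True by (simp add: e_def field_simps)
    finally show ?thesis .
  qed (use nn[of j] in \<open>simp add: e_def\<close>)
  have eorth: "e i \<bullet> e j = (if i = j \<and> 0 < \<nu> i then 1 else 0)" for i j
  proof (cases "0 < \<nu> i \<and> 0 < \<nu> j")
    case True
    have "e i \<bullet> g j = (LINT y|P. (\<Phi> y \<bullet> e i) * \<psi> j y)" using g True by simp
    also have "\<dots> = (LINT y|P. sqrt (\<nu> i) * (\<psi> i y * \<psi> j y))"
    proof (rule integral_cong_AE)
      show "AE y in P. (\<Phi> y \<bullet> e i) * \<psi> j y = sqrt (\<nu> i) * (\<psi> i y * \<psi> j y)"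
        using A by eventually_elim (simp add: ev)
    qed auto
    also have "\<dots> = sqrt (\<nu> i) * (if i = j then 1 else 0)" using orth True by simp
    finally show ?thesis using True by (simp add: e_def)
  qed (auto simp: e_def)
  \<comment> \<open>On \<open>A\<close> this is the Mercer expansion at the diagonal point
    \<open>(x, x)\<close>.\<close>
  have compl: "(\<lambda>j. (\<Phi> x \<bullet> e j)\<^sup>2) sums (norm (\<Phi> x))\<^sup>2" for x
  proof (cases "x \<in> A")
    case True
    have "(\<lambda>n. \<Sum>j<n. \<nu> j * \<psi> j x * \<psi> j x) \<longlonglongrightarrow> K x x"
      using tendsto_uniform_limitI[OF lim, of "(x, x)"] True by simp
    moreover have "(\<Phi> x \<bullet> e j)\<^sup>2 = \<nu> j * \<psi> j x * \<psi> j x" for j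
      using nn[of j] by (simp add: ev[OF True] power_mult_distrib power2_eq_square mult_ac)
    ultimately show ?thesis using True by (simp add: sums_def K power2_norm_eq_inner)
  qed (simp add: outside)
  have "feature_spectrum P \<Phi> G \<nu> e"
    by unfold_locales (use nn mono eorth cov compl in auto)
  then show ?thesis using ev that by blast
qed

text \<open>The trace of a product of two Gram matrices is the squared Hilbert-Schmidt norm of the
  matrix of mixed inner products. It evaluates the pairings of two projections in
  coordinates.\<close>

lemma sum_gram_product:
  fixes f g :: "'j \<Rightarrow> 'a \<Rightarrow> real"
  shows "(\<Sum>a\<in>I. \<Sum>b\<in>I. (\<Sum>j\<in>J. f j a * f j b) * (\<Sum>k\<in>L. g k a * g k b))
    = (\<Sum>j\<in>J. \<Sum>k\<in>L. (\<Sum>a\<in>I. f j a * g k a)\<^sup>2)"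
proof -
  have "(\<Sum>a\<in>I. \<Sum>b\<in>I. (\<Sum>j\<in>J. f j a * f j b) * (\<Sum>k\<in>L. g k a * g k b))
      = (\<Sum>a\<in>I. \<Sum>b\<in>I. \<Sum>j\<in>J. \<Sum>k\<in>L. (f j a * g k a) * (f j b * g k b))"
    by (simp add: sum_product mult_ac)
  also have "\<dots> = (\<Sum>a\<in>I. \<Sum>j\<in>J. \<Sum>b\<in>I. \<Sum>k\<in>L. (f j a * g k a) * (f j b * g k b))"
    by (rule sum.cong[OF refl]) (rule sum.swap)
  also have "\<dots> = (\<Sum>j\<in>J. \<Sum>a\<in>I. \<Sum>k\<in>L. \<Sum>b\<in>I. (f j a * g k a) * (f j b * g k b))"
    by (subst sum.swap) (intro sum.cong refl sum.swap)
  also have "\<dots> = (\<Sum>j\<in>J. \<Sum>k\<in>L. \<Sum>a\<in>I. \<Sum>b\<in>I. (f j a * g k a) * (f j b * g k b))"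
    by (intro sum.cong refl sum.swap)
  finally show ?thesis by (simp add: power2_eq_square sum_product)
qed

context feature_spectrum
begin

text \<open>The entries of \<Sigma> - \<Sigma>' in the coordinates of \<open>e\<close>; its
  \<open>L2_set\<close> over a square block is a truncated Hilbert-Schmidt norm.\<close>

definition dev :: "nat \<Rightarrow> (nat \<Rightarrow> 'a) \<Rightarrow> nat \<times> nat \<Rightarrow> real" where
  "dev p xs = (\<lambda>(a, b). (LINT y|P. (\<Phi> y \<bullet> e a) * (\<Phi> y \<bullet> e b))
     - (\<Sum>k<p. (\<Phi> (xs k) \<bullet> e a) * (\<Phi> (xs k) \<bullet> e b)) / real p)"

text \<open>In every block the rank one matrix of \<Phi> x has Frobenius norm
  \<open>(norm (trunc N x))\<^sup>2\<close>, at most \<open>G\<^sup>2\<close>, so all blocks obey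
  the same bound with the same probability. The events decrease in \<open>N\<close>, so continuity
  from above avoids the loss of a union bound.\<close>

lemma covariance_concentration:
  assumes G: "G > 0" and p: "p > 0" and \<alpha>: "\<alpha> > 0"
  defines "M \<equiv> PiM {..<p} (\<lambda>_. P)"
    and "t \<equiv> 2 * G\<^sup>2 / sqrt p * (1 + sqrt (\<alpha> / 2))"
  shows "{xs \<in> space M. \<forall>N. L2_set (dev p xs) ({..<N} \<times> {..<N}) \<le> t} \<in> sets M"
    and "measure M {xs \<in> space M. \<forall>N. L2_set (dev p xs) ({..<N} \<times> {..<N}) \<le> t} \<ge> 1 - exp (- \<alpha>)"
proof -
  interpret M: prob_space M unfolding M_def by (rule prob_space_PiM) unfold_locales
  define F where "F N = {xs \<in> space M. L2_set (dev p xs) ({..<N} \<times> {..<N}) \<le> t}" for N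
  have [measurable]: "(\<lambda>xs. dev p xs i) \<in> borel_measurable M" for i
    unfolding dev_def M_def by (cases i) simp
  have Fm: "F N \<in> sets M" for N
    unfolding F_def L2_set_def by measurable
  have eq: "{xs \<in> space M. \<forall>N. L2_set (dev p xs) ({..<N} \<times> {..<N}) \<le> t} = (\<Inter>N. F N)"
    by (auto simp: F_def)
  show "{xs \<in> space M. \<forall>N. L2_set (dev p xs) ({..<N} \<times> {..<N}) \<le> t} \<in> sets M"
    unfolding eq using Fm by (intro sets.countable_INT) auto
  have "decseq F"
  proof (intro decseq_SucI subsetI)
    fix N xs assume "xs \<in> F (Suc N)"
    moreover have "L2_set (dev p xs) ({..<N} \<times> {..<N}) \<le> L2_set (dev p xs) ({..<Suc N} \<times> {..<Suc N})"
      unfolding L2_set_def by (intro real_sqrt_le_mono sum_mono2) auto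
    ultimately show "xs \<in> F N" by (auto simp: F_def)
  qed
  then have "(\<lambda>N. measure M (F N)) \<longlonglongrightarrow> measure M (\<Inter>N. F N)"
    using Fm by (intro M.finite_Lim_measure_decseq) auto
  moreover have "1 - exp (- \<alpha>) \<le> measure M (F N)" for N
  proof -
    have "L2_set (\<lambda>i. (\<Phi> x \<bullet> e (fst i)) * (\<Phi> x \<bullet> e (snd i))) ({..<N} \<times> {..<N}) \<le> G\<^sup>2" for x
    proof -
      have "(\<Sum>i\<in>{..<N} \<times> {..<N}. ((\<Phi> x \<bullet> e (fst i)) * (\<Phi> x \<bullet> e (snd i)))\<^sup>2) = ((norm (trunc N x))\<^sup>2)\<^sup>2"
        by (simp add: norm_trunc power2_eq_square[of "sum _ _"] sum_product sum.cartesian_product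
            power_mult_distrib case_prod_unfold)
      then have "L2_set (\<lambda>i. (\<Phi> x \<bullet> e (fst i)) * (\<Phi> x \<bullet> e (snd i))) ({..<N} \<times> {..<N}) = (norm (trunc N x))\<^sup>2"
        unfolding L2_set_def by (simp only: real_sqrt_abs) simp
      also have "\<dots> \<le> G\<^sup>2" by (intro power_mono norm_trunc_le) simp
      finally show ?thesis .
    qed
    from empirical_mean_concentration[OF prob_space_axioms _ _ this _ p \<alpha>, of "\<lambda>x. x"] G
    show ?thesis
      unfolding F_def M_def t_def dev_def case_prod_unfold by simp
  qed
  ultimately have "1 - exp (- \<alpha>) \<le> measure M (\<Inter>N. F N)"
    by (intro LIMSEQ_le_const) auto
  then show "measure M {xs \<in> space M. \<forall>N. L2_set (dev p xs) ({..<N} \<times> {..<N}) \<le> t} \<ge> 1 - exp (- \<alpha>)"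
    unfolding eq .
qed

text \<open>Truncating both factors yields finite combinations of entries of \<open>dev\<close>; the
  limit recovers the quadratic form of \<Sigma> - \<Sigma>' from its blocks.\<close>

lemma dev_quadratic_form:
  "(\<lambda>N. \<Sum>(a, b)\<in>{..<N} \<times> {..<N}. dev p xs (a, b) * ((h \<bullet> e a) * (h \<bullet> e b)))
     \<longlonglongrightarrow> (LINT x|P. (\<Phi> x \<bullet> h)\<^sup>2) - (\<Sum>k<p. (\<Phi> (xs k) \<bullet> h)\<^sup>2) / p"
proof -
  have sq: "(trunc N x \<bullet> h)\<^sup>2 = (\<Sum>(a, b)\<in>{..<N} \<times> {..<N}. ((\<Phi> x \<bullet> e a) * (\<Phi> x \<bullet> e b)) * ((h \<bullet> e a) * (h \<bullet> e b)))" for N x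
    by (simp add: trunc_inner power2_eq_square sum_product sum.cartesian_product mult_ac)
  have "(\<lambda>N. LINT x|P. (trunc N x \<bullet> h)\<^sup>2) \<longlonglongrightarrow> (LINT x|P. (\<Phi> x \<bullet> h)\<^sup>2)"
  proof (rule integral_dominated_convergence[where w = "\<lambda>_. (G * norm h)\<^sup>2"])
    show "AE x in P. (\<lambda>N. (trunc N x \<bullet> h)\<^sup>2) \<longlonglongrightarrow> (\<Phi> x \<bullet> h)\<^sup>2"
      by (intro AE_I2 tendsto_intros trunc_tendsto)
    show "AE x in P. norm ((trunc N x \<bullet> h)\<^sup>2) \<le> (G * norm h)\<^sup>2" for N
      using power_mono[OF trunc_inner_bound, of _ _ _ 2] by (intro AE_I2) simp
  qed auto
  moreover have "(\<lambda>N. (\<Sum>k<p. (trunc N (xs k) \<bullet> h)\<^sup>2) / p) \<longlonglongrightarrow> (\<Sum>k<p. (\<Phi> (xs k) \<bullet> h)\<^sup>2) / p"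
    by (cases "p = 0") (auto intro!: tendsto_intros trunc_tendsto)
  ultimately have "(\<lambda>N. (LINT x|P. (trunc N x \<bullet> h)\<^sup>2) - (\<Sum>k<p. (trunc N (xs k) \<bullet> h)\<^sup>2) / p)
      \<longlonglongrightarrow> (LINT x|P. (\<Phi> x \<bullet> h)\<^sup>2) - (\<Sum>k<p. (\<Phi> (xs k) \<bullet> h)\<^sup>2) / p"
    by (rule tendsto_diff)
  moreover have "(LINT x|P. (trunc N x \<bullet> h)\<^sup>2) - (\<Sum>k<p. (trunc N (xs k) \<bullet> h)\<^sup>2) / p
      = (\<Sum>(a, b)\<in>{..<N} \<times> {..<N}. dev p xs (a, b) * ((h \<bullet> e a) * (h \<bullet> e b)))" for N
  proof -
    have "(LINT x|P. (trunc N x \<bullet> h)\<^sup>2)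
        = (\<Sum>(a, b)\<in>{..<N} \<times> {..<N}. (LINT x|P. (\<Phi> x \<bullet> e a) * (\<Phi> x \<bullet> e b)) * ((h \<bullet> e a) * (h \<bullet> e b)))"
      unfolding sq case_prod_unfold
      by (subst Bochner_Integration.integral_sum) (auto intro!: integrable_feature_prod integrable_mult_left)
    moreover have "(\<Sum>k<p. (trunc N (xs k) \<bullet> h)\<^sup>2)
        = (\<Sum>(a, b)\<in>{..<N} \<times> {..<N}. (\<Sum>k<p. (\<Phi> (xs k) \<bullet> e a) * (\<Phi> (xs k) \<bullet> e b)) * ((h \<bullet> e a) * (h \<bullet> e b)))"
      unfolding sq case_prod_unfold by (subst sum.swap) (simp add: sum_distrib_right)
    ultimately show ?thesis
      by (simp add: dev_def case_prod_unfold left_diff_distrib sum_subtractf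
          sum_divide_distrib[of _ "{..<N} \<times> {..<N}"])
  qed
  ultimately show ?thesis by simp
qed

text \<open>Cauchy-Schwarz in the Hilbert-Schmidt inner product. The root bounds the norm of the
  difference of the two projections: its square is at most \<open>m + m\<close> minus twice the
  trace of their product, the double sum.\<close>

lemma trace_deviation_le:
  assumes u: "orthonormal_upto m u" and pos: "\<And>j. j < m \<Longrightarrow> 0 < \<mu> j"
    and dev: "\<And>N. L2_set (dev p xs) ({..<N} \<times> {..<N}) \<le> t"
  defines "d \<equiv> \<lambda>h. (LINT x|P. (\<Phi> x \<bullet> h)\<^sup>2) - (\<Sum>k<p. (\<Phi> (xs k) \<bullet> h)\<^sup>2) / p"
  shows "(\<Sum>j<m. d (e j)) - (\<Sum>k<m. d (u k))
     \<le> t * sqrt (2 * (real m - (\<Sum>k<m. \<Sum>j<m. (u k \<bullet> e j)\<^sup>2)))"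
proof -
  define D where "D = (\<Sum>k<m. \<Sum>j<m. (u k \<bullet> e j)\<^sup>2)"
  define q where "q N h = (\<Sum>(a, b)\<in>{..<N} \<times> {..<N}. dev p xs (a, b) * ((h \<bullet> e a) * (h \<bullet> e b)))" for N h
  have "(\<lambda>N. (\<Sum>j<m. q N (e j)) - (\<Sum>k<m. q N (u k))) \<longlonglongrightarrow> (\<Sum>j<m. d (e j)) - (\<Sum>k<m. d (u k))"
    unfolding q_def d_def by (intro tendsto_intros dev_quadratic_form)
  \<comment> \<open>From \<open>m \<le> N\<close> on, the block contains every \<open>e j\<close>
    with \<open>j < m\<close>, so \<open>coord\<close> reproduces inner products with them
    exactly.\<close>
  moreover have "(\<Sum>j<m. q N (e j)) - (\<Sum>k<m. q N (u k)) \<le> t * sqrt (2 * (real m - D))" if N: "m \<le> N" for N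
  proof -
    \<comment> \<open>\<open>r1\<close> and \<open>r2\<close> are the coordinate matrices of the
      projections onto the spans of the \<open>e j\<close> and of the \<open>u k\<close>.\<close>
    define r1 where "r1 a b = (\<Sum>j<m. (e j \<bullet> e a) * (e j \<bullet> e b))" for a b
    define r2 where "r2 a b = (\<Sum>k<m. (u k \<bullet> e a) * (u k \<bullet> e b))" for a b
    let ?N2 = "{..<N} \<times> {..<N}"
    have "(\<Sum>j<m. q N (e j)) - (\<Sum>k<m. q N (u k)) = (\<Sum>i\<in>?N2. dev p xs i * (r1 (fst i) (snd i) - r2 (fst i) (snd i)))"
      unfolding q_def case_prod_unfold r1_def r2_def
      by (subst (1 2) sum.swap) (simp add: sum_distrib_left right_diff_distrib sum_subtractf)
    also have "\<dots> \<le> (\<Sum>i\<in>?N2. \<bar>dev p xs i\<bar> * \<bar>r1 (fst i) (snd i) - r2 (fst i) (snd i)\<bar>)"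
      by (intro sum_mono) (metis abs_ge_self abs_mult)
    also have "\<dots> \<le> L2_set (dev p xs) ?N2 * L2_set (\<lambda>i. r1 (fst i) (snd i) - r2 (fst i) (snd i)) ?N2"
      by (rule L2_set_mult_ineq)
    also have "\<dots> \<le> t * L2_set (\<lambda>i. r1 (fst i) (snd i) - r2 (fst i) (snd i)) ?N2"
      by (intro mult_right_mono dev) simp
    also have "\<dots> \<le> t * sqrt (2 * (real m - D))"
    proof (intro mult_left_mono)
      have coord: "(\<Sum>a<N. (e j \<bullet> e a) * (h \<bullet> e a)) = h \<bullet> e j" if "j < m" for h j
      proof -
        have "(\<Sum>a<N. (e j \<bullet> e a) * (h \<bullet> e a)) = (\<Sum>a<N. if a = j then h \<bullet> e j else 0)"
          using pos[OF that] by (intro sum.cong) (auto simp: eigenvector_orth)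
        then show ?thesis using that N by simp
      qed
      have "(\<Sum>a<N. \<Sum>b<N. r1 a b * r1 a b) = (\<Sum>j<m. \<Sum>k<m. (e k \<bullet> e j)\<^sup>2)"
        unfolding r1_def sum_gram_product by (simp add: coord)
      also have "\<dots> = (\<Sum>j<m. \<Sum>k<m. if k = j then 1 else 0)"
        using pos by (intro sum.cong) (auto simp: eigenvector_orth)
      finally have 11: "(\<Sum>a<N. \<Sum>b<N. r1 a b * r1 a b) = m" by simp
      have "(\<Sum>a<N. \<Sum>b<N. r1 a b * r2 a b) = (\<Sum>j<m. \<Sum>k<m. (u k \<bullet> e j)\<^sup>2)"
        unfolding r1_def r2_def sum_gram_product by (simp add: coord)
      then have 12: "(\<Sum>a<N. \<Sum>b<N. r1 a b * r2 a b) = D"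
        unfolding D_def by (subst sum.swap)
      have "(\<Sum>a<N. \<Sum>b<N. r2 a b * r2 a b) = (\<Sum>j<m. \<Sum>k<m. (\<Sum>a<N. (u j \<bullet> e a) * (u k \<bullet> e a))\<^sup>2)"
        unfolding r2_def sum_gram_product ..
      \<comment> \<open>Only an inequality, since the \<open>u k\<close> may leave the span of the
        first \<open>N\<close> eigenvectors: \<open>w\<close> is the component of \<open>u j\<close>
        inside it.\<close>
      also have "\<dots> \<le> (\<Sum>j<m. 1)"
      proof (rule sum_mono)
        fix j assume j: "j \<in> {..<m}"
        define w where "w = (\<Sum>a<N. (u j \<bullet> e a) *\<^sub>R e a)"
        have "(\<Sum>k<m. (\<Sum>a<N. (u j \<bullet> e a) * (u k \<bullet> e a))\<^sup>2) = (\<Sum>k<m. (w \<bullet> u k)\<^sup>2)"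
          by (simp add: w_def inner_sum_left inner_commute[of "e _"])
        also have "\<dots> \<le> (norm w)\<^sup>2" by (rule bessel_upto[OF u])
        also have "\<dots> = (\<Sum>a<N. (u j \<bullet> e a)\<^sup>2 * (norm (e a))\<^sup>2)"
          unfolding w_def by (rule norm_sum_scaleR_orthogonal) (auto simp: eigenvector_orth)
        also have "\<dots> \<le> (\<Sum>a<N. (u j \<bullet> e a)\<^sup>2)"
          by (intro sum_mono mult_left_le) (auto simp: power_le_one eigenvector_norm_le)
        also have "\<dots> \<le> (norm (u j))\<^sup>2" by (rule eigenvectors_bessel) simp
        also have "\<dots> = 1" using orthonormal_uptoD[OF u, of j j] j by (simp add: power2_norm_eq_inner)
        finally show "(\<Sum>k<m. (\<Sum>a<N. (u j \<bullet> e a) * (u k \<bullet> e a))\<^sup>2) \<le> 1" .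
      qed
      finally have 22: "(\<Sum>a<N. \<Sum>b<N. r2 a b * r2 a b) \<le> m" by simp
      have "(\<Sum>i\<in>?N2. (r1 (fst i) (snd i) - r2 (fst i) (snd i))\<^sup>2)
          = (\<Sum>a<N. \<Sum>b<N. (r1 a b - r2 a b)\<^sup>2)"
        by (simp add: sum.cartesian_product case_prod_unfold)
      also have "\<dots> = (\<Sum>a<N. \<Sum>b<N. r1 a b * r1 a b + r2 a b * r2 a b - 2 * (r1 a b * r2 a b))"
        by (intro sum.cong refl) (simp add: power2_eq_square algebra_simps)
      also have "\<dots> = (\<Sum>a<N. \<Sum>b<N. r1 a b * r1 a b) + (\<Sum>a<N. \<Sum>b<N. r2 a b * r2 a b) - 2 * (\<Sum>a<N. \<Sum>b<N. r1 a b * r2 a b)"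
        by (simp add: sum.distrib sum_subtractf sum_distrib_left)
      also have "\<dots> \<le> 2 * (m - D)" using 11 12 22 by simp
      finally show "L2_set (\<lambda>i. r1 (fst i) (snd i) - r2 (fst i) (snd i)) ?N2 \<le> sqrt (2 * (real m - D))"
        unfolding L2_set_def by (rule real_sqrt_le_mono)
      show "0 \<le> t" using dev[of 0] by simp
    qed
    finally show ?thesis .
  qed
  ultimately show ?thesis
    unfolding D_def[symmetric] by (intro LIMSEQ_le_const2) auto
qed

text \<open>The weight \<open>w j\<close> is the squared norm of the projection of
  \<open>e j\<close> onto the span of \<open>u\<close>. The weight missing below index
  \<open>m\<close> is worth at least \<open>\<mu> (m - 1)\<close> per unit, the weight found from
  \<open>m\<close> on at most \<open>\<mu> m\<close>, and the total is at most \<open>m\<close>;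
  each displaced unit therefore costs the gap.\<close>

lemma trace_gap:
  assumes u: "orthonormal_upto m u" and m: "m \<ge> 1"
  shows "(\<mu> (m - 1) - \<mu> m) * (real m - (\<Sum>k<m. \<Sum>j<m. (u k \<bullet> e j)\<^sup>2))
     \<le> (\<Sum>j<m. \<mu> j) - (\<Sum>k<m. LINT x|P. (\<Phi> x \<bullet> u k)\<^sup>2)"
proof -
  define w where "w j = (\<Sum>k<m. (u k \<bullet> e j)\<^sup>2)" for j
  define D where "D = (\<Sum>j<m. w j)"
  have w1: "w j \<le> 1" for j
  proof -
    have "w j = (\<Sum>k<m. (e j \<bullet> u k)\<^sup>2)" by (simp add: w_def inner_commute)
    also have "\<dots> \<le> (norm (e j))\<^sup>2" by (rule bessel_upto[OF u])
    also have "\<dots> \<le> 1" using eigenvector_norm_le by (simp add: power_le_one)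
    finally show ?thesis .
  qed
  have w0: "0 \<le> w j" for j by (simp add: w_def sum_nonneg)
  have wsum: "(\<Sum>j<N. w j) \<le> m" for N
  proof -
    have "(\<Sum>j<N. w j) = (\<Sum>k<m. \<Sum>j<N. (u k \<bullet> e j)\<^sup>2)" unfolding w_def by (rule sum.swap)
    also have "\<dots> \<le> (\<Sum>k<m. (norm (u k))\<^sup>2)" by (intro sum_mono eigenvectors_bessel) simp
    also have "\<dots> = m" using orthonormal_uptoD[OF u] by (simp add: power2_norm_eq_inner)
    finally show ?thesis .
  qed
  have "(\<lambda>N. \<Sum>k<m. \<Sum>j<N. \<mu> j * (u k \<bullet> e j)\<^sup>2) \<longlonglongrightarrow> (\<Sum>k<m. LINT x|P. (\<Phi> x \<bullet> u k)\<^sup>2)"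
    by (intro tendsto_sum variance_sums[unfolded sums_def])
  moreover have "(\<Sum>k<m. \<Sum>j<N. \<mu> j * (u k \<bullet> e j)\<^sup>2) = (\<Sum>j<N. \<mu> j * w j)" for N
    by (subst sum.swap) (simp add: w_def sum_distrib_left)
  ultimately have "(\<lambda>N. \<Sum>j<N. \<mu> j * w j) \<longlonglongrightarrow> (\<Sum>k<m. LINT x|P. (\<Phi> x \<bullet> u k)\<^sup>2)"
    by simp
  moreover have "(\<Sum>j<N. \<mu> j * w j) \<le> (\<Sum>j<m. \<mu> j) - (\<mu> (m - 1) - \<mu> m) * (m - D)" if N: "m \<le> N" for N
  proof -
    have split: "(\<Sum>j<N. f j) = (\<Sum>j<m. f j) + (\<Sum>j\<in>{m..<N}. f j)" for f :: "nat \<Rightarrow> real"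
      using N by (simp add: atLeast0LessThan[symmetric] sum.atLeastLessThan_concat)
    have "(\<Sum>j\<in>{m..<N}. \<mu> j * w j) \<le> (\<Sum>j\<in>{m..<N}. \<mu> m * w j)"
      by (intro sum_mono mult_right_mono eigenvalue_antimono w0) simp
    also have "\<dots> = \<mu> m * (\<Sum>j\<in>{m..<N}. w j)" by (simp add: sum_distrib_left)
    also have "\<dots> \<le> \<mu> m * (m - D)"
      using wsum[of N] split[of w] by (intro mult_left_mono eigenvalue_nonneg) (simp add: D_def)
    finally have hi: "(\<Sum>j\<in>{m..<N}. \<mu> j * w j) \<le> \<mu> m * (m - D)" .
    \<comment> \<open>The missing weight \<open>1 - w j\<close> is charged at the smallest of the
      top eigenvalues.\<close>
    have "(\<Sum>j<m. \<mu> j * w j) \<le> (\<Sum>j<m. \<mu> j - \<mu> (m - 1) * (1 - w j))"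
    proof (rule sum_mono)
      fix j assume "j \<in> {..<m}"
      then have "\<mu> (m - 1) * (1 - w j) \<le> \<mu> j * (1 - w j)"
        using w1 by (intro mult_right_mono eigenvalue_antimono) auto
      then show "\<mu> j * w j \<le> \<mu> j - \<mu> (m - 1) * (1 - w j)" by (simp add: algebra_simps)
    qed
    also have "\<dots> = (\<Sum>j<m. \<mu> j) - \<mu> (m - 1) * (m - D)"
      by (simp add: sum_subtractf sum_distrib_left[symmetric] D_def)
    finally show ?thesis using hi unfolding split[of "\<lambda>j. \<mu> j * w j"] by (simp add: left_diff_distrib)
  qed
  ultimately have "(\<Sum>k<m. LINT x|P. (\<Phi> x \<bullet> u k)\<^sup>2) \<le> (\<Sum>j<m. \<mu> j) - (\<mu> (m - 1) - \<mu> m) * (m - D)"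
    by (intro LIMSEQ_le_const2) auto
  moreover have "(\<Sum>k<m. \<Sum>j<m. (u k \<bullet> e j)\<^sup>2) = D"
    unfolding D_def w_def by (rule sum.swap)
  ultimately show ?thesis by simp
qed

end

section \<open>Perturbation of the top eigenspace\<close>

context feature_spectrum
begin

text \<open>A Davis-Kahan bound in which only the gap of \<Sigma> occurs: the sample covariance
  enters through \<open>dev\<close> and the trace comparison \<open>top\<close> alone.\<close>

lemma eigenspace_deviation:
  assumes u: "orthonormal_upto m u" and m: "m \<ge> 1" and gap: "\<mu> m < \<mu> (m - 1)"
    and dev: "\<And>N. L2_set (dev p xs) ({..<N} \<times> {..<N}) \<le> t"
    and top: "(\<Sum>j<m. \<Sum>i<p. (\<Phi> (xs i) \<bullet> e j)\<^sup>2) \<le> (\<Sum>k<m. \<Sum>i<p. (\<Phi> (xs i) \<bullet> u k)\<^sup>2)"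
  shows "(\<Sum>j<m. (norm (e j - proj_upto m u (e j)))\<^sup>2) \<le> 2 * (t / (\<mu> (m - 1) - \<mu> m))\<^sup>2"
proof -
  have pos: "0 < \<mu> j" if "j < m" for j
    using eigenvalue_antimono[of j "m - 1"] eigenvalue_nonneg[of m] gap that by fastforce
  define g where "g = \<mu> (m - 1) - \<mu> m"
  have g: "g > 0" using gap by (simp add: g_def)
  define \<tau> where "\<tau> = (\<Sum>j<m. (norm (e j - proj_upto m u (e j)))\<^sup>2)"
  have \<tau>0: "\<tau> \<ge> 0" by (simp add: \<tau>_def sum_nonneg)
  have "\<tau> = (\<Sum>j<m. 1 - (\<Sum>k<m. (u k \<bullet> e j)\<^sup>2))"
    unfolding \<tau>_def norm_residual_proj_upto[OF u]
    using pos by (intro sum.cong refl) (simp add: power2_norm_eq_inner eigenvector_orth inner_commute)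
  also have "\<dots> = m - (\<Sum>k<m. \<Sum>j<m. (u k \<bullet> e j)\<^sup>2)"
    by (simp add: sum_subtractf) (rule sum.swap)
  finally have \<tau>: "real m - (\<Sum>k<m. \<Sum>j<m. (u k \<bullet> e j)\<^sup>2) = \<tau>" by simp
  have "g * \<tau> \<le> (\<Sum>j<m. \<mu> j) - (\<Sum>k<m. LINT x|P. (\<Phi> x \<bullet> u k)\<^sup>2)"
    using trace_gap[OF u m] unfolding \<tau> g_def .
  moreover have "(\<Sum>j<m. \<mu> j) - (\<Sum>j<m. (\<Sum>i<p. (\<Phi> (xs i) \<bullet> e j)\<^sup>2) / p)
      - ((\<Sum>k<m. LINT x|P. (\<Phi> x \<bullet> u k)\<^sup>2) - (\<Sum>k<m. (\<Sum>i<p. (\<Phi> (xs i) \<bullet> u k)\<^sup>2) / p))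
      \<le> t * sqrt (2 * \<tau>)"
    using trace_deviation_le[OF u pos dev] unfolding \<tau> variance_eigenvector sum_subtractf .
  moreover have "(\<Sum>j<m. (\<Sum>i<p. (\<Phi> (xs i) \<bullet> e j)\<^sup>2) / p) \<le> (\<Sum>k<m. (\<Sum>i<p. (\<Phi> (xs i) \<bullet> u k)\<^sup>2) / p)"
    using top by (simp add: sum_divide_distrib[symmetric] divide_right_mono)
  ultimately have le: "g * \<tau> \<le> t * sqrt (2 * \<tau>)" by linarith
  \<comment> \<open>Squaring leaves \<tau>^2 against \<tau>, and one factor cancels unless \<tau> =
    0.\<close>
  have "(g * \<tau>)\<^sup>2 \<le> (t * sqrt (2 * \<tau>))\<^sup>2"
    using le g \<tau>0 by (intro power_mono) auto
  then have "g\<^sup>2 * \<tau> * \<tau> \<le> (2 * t\<^sup>2) * \<tau>"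
    using \<tau>0 by (simp add: power_mult_distrib power2_eq_square[of \<tau>] mult_ac)
  then have "g\<^sup>2 * \<tau> \<le> 2 * t\<^sup>2"
    using \<tau>0 g by (cases "\<tau> = 0") auto
  then have "\<tau> \<le> 2 * (t / g)\<^sup>2"
    using g by (simp add: power_divide field_simps)
  then show ?thesis unfolding \<tau>_def g_def .
qed

text \<open>Linearity of the residual and Cauchy-Schwarz. The index set varies: all top indices for
  truncated features, initial segments \<open>{..i}\<close> in the min-max argument.\<close>

lemma norm_residual_combination:
  assumes J: "J \<subseteq> {..<m}" and \<tau>: "(\<Sum>j<m. (norm (e j - proj_upto m u (e j)))\<^sup>2) \<le> \<tau>"
    and h: "h = (\<Sum>j\<in>J. c j *\<^sub>R e j)"
  shows "(norm (h - proj_upto m u h))\<^sup>2 \<le> \<tau> * (\<Sum>j\<in>J. (c j)\<^sup>2)"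
proof -
  have "h - proj_upto m u h = (\<Sum>j\<in>J. c j *\<^sub>R (e j - proj_upto m u (e j)))"
    by (simp add: h linear_sum[OF linear_proj_upto] linear_scale[OF linear_proj_upto]
        scaleR_diff_right sum_subtractf)
  then have "(norm (h - proj_upto m u h))\<^sup>2
      \<le> (\<Sum>j\<in>J. (c j)\<^sup>2) * (\<Sum>j\<in>J. (norm (e j - proj_upto m u (e j)))\<^sup>2)"
    by (simp only: norm_sum_scaleR_le)
  also have "\<dots> \<le> (\<Sum>j\<in>J. (c j)\<^sup>2) * \<tau>"
    using J by (intro mult_left_mono order_trans[OF _ \<tau>] sum_mono2) (auto simp: sum_nonneg)
  finally show ?thesis by (simp add: mult.commute)
qed

lemma norm_feature_residual:
  assumes u: "orthonormal_upto m u"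
    and \<tau>: "(\<Sum>j<m. (norm (e j - proj_upto m u (e j)))\<^sup>2) \<le> \<tau>"
  shows "norm (\<Phi> x - proj_upto m u (\<Phi> x)) \<le> G * sqrt \<tau> + norm (\<Phi> x - trunc m x)"
proof -
  let ?Q = "proj_upto m u"
  have \<tau>0: "0 \<le> \<tau>" by (rule order_trans[OF _ \<tau>]) (simp add: sum_nonneg)
  have "(norm (trunc m x - ?Q (trunc m x)))\<^sup>2 \<le> \<tau> * (\<Sum>j<m. (\<Phi> x \<bullet> e j)\<^sup>2)"
    by (rule norm_residual_combination[OF order_refl \<tau>]) (simp add: trunc_def)
  also have "\<dots> \<le> \<tau> * G\<^sup>2"
    unfolding norm_trunc[symmetric] by (intro mult_left_mono power_mono norm_trunc_le \<tau>0) simp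
  also have "\<dots> = (G * sqrt \<tau>)\<^sup>2" using \<tau>0 by (simp add: power_mult_distrib mult.commute)
  finally have 1: "norm (trunc m x - ?Q (trunc m x)) \<le> G * sqrt \<tau>"
    by (rule power2_le_imp_le) (simp add: G_nonneg \<tau>0)
  have 2: "norm (y - ?Q y) \<le> norm y" for y
  proof (rule power2_le_imp_le)
    show "(norm (y - ?Q y))\<^sup>2 \<le> (norm y)\<^sup>2"
      unfolding norm_residual_proj_upto[OF u] by (simp add: sum_nonneg)
  qed simp
  define r where "r = \<Phi> x - trunc m x"
  have "\<Phi> x - ?Q (\<Phi> x) = (trunc m x - ?Q (trunc m x)) + (r - ?Q r)"
    by (simp add: r_def linear_diff[OF linear_proj_upto])
  then have "norm (\<Phi> x - ?Q (\<Phi> x)) \<le> norm (trunc m x - ?Q (trunc m x)) + norm (r - ?Q r)"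
    by (simp only: norm_triangle_ineq)
  then show ?thesis using 1 2[of r] by (simp add: r_def)
qed

text \<open>The eigenvectors \<open>f j\<close> lie in the range of the projection, where both
  covariances have the same quadratic form. It is tested on a vector in the span of the leading
  \<open>f\<close> that is orthogonal to the leading \<open>e\<close>.\<close>

lemma projected_eigenvalue_le:
  assumes u: "orthonormal_upto m u" and proj: "feature_spectrum P (\<lambda>x. proj_upto m u (\<Phi> x)) G \<nu> f"
  shows "\<nu> i \<le> \<mu> i"
proof (cases "0 < \<nu> i")
  case True
  let ?Q = "proj_upto m u"
  interpret Q: feature_spectrum P "\<lambda>x. ?Q (\<Phi> x)" G \<nu> f by (rule proj)
  have inv: "?Q (f j) = f j" for j
  proof (cases "0 < \<nu> j")
    case True
    \<comment> \<open>The part of \<open>f j\<close> outside the range is annihilated by the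
      projection, so the eigenvalue equation tested with it gives orthogonality to
      \<open>f j\<close>.\<close>
    define h where "h = f j - ?Q (f j)"
    have Qh: "?Q h = 0" by (simp add: h_def linear_diff[OF linear_proj_upto] proj_upto_idem[OF u])
    have "\<nu> j * (h \<bullet> f j) = 0"
      using Q.covariance[of h j] by (simp add: proj_upto_symmetric[of m u "\<Phi> _" h] Qh)
    moreover have "h \<bullet> ?Q (f j) = 0"
      using proj_upto_symmetric[of m u h "f j"] Qh by simp
    ultimately have "h \<bullet> h = 0" using True by (simp add: h_def inner_diff_right)
    then show ?thesis by (simp add: h_def)
  next
    case False
    then have "f j = 0" using Q.eigenvalue_nonneg[of j] by (intro Q.eigenvector_zero) simp
    then show ?thesis by (simp add: linear_0[OF linear_proj_upto])
  qed
  obtain c h where h: "h = (\<Sum>j\<le>i. c j *\<^sub>R f j)" "norm h = 1" "\<And>j. j < i \<Longrightarrow> h \<bullet> e j = 0"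
    using Q.eigenspan_meets_orthogonal[OF True, of e] by blast
  have Qh: "?Q h = h"
    by (simp add: h(1) linear_sum[OF linear_proj_upto] linear_scale[OF linear_proj_upto] inv)
  have "\<nu> i \<le> (LINT x|P. (?Q (\<Phi> x) \<bullet> h)\<^sup>2)"
    using Q.variance_ge_on_span[OF True h(1)] h(2) by simp
  also have "\<dots> = (LINT x|P. (\<Phi> x \<bullet> h)\<^sup>2)"
    by (simp add: proj_upto_symmetric[of m u "\<Phi> _" h] Qh)
  also have "\<dots> \<le> \<mu> i"
    using variance_le_of_orth[of i h] h(2,3) by simp
  finally show ?thesis .
next
  case False
  then show ?thesis using eigenvalue_nonneg[of i] by linarith
qed

text \<open>With \<open>r = h - Q h\<close> for the projection \<open>Q\<close>, the cross term \<open>\<langle>r, \<Sigma> h\<rangle>\<close> equals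
  \<open>\<langle>r, (1 - Q) \<Sigma> h\<rangle>\<close>, and \<open>\<Sigma> h\<close> is again in the top eigenspace: the loss is quadratic in the angle.\<close>
lemma projected_eigenvalue_ge:
  assumes u: "orthonormal_upto m u" and proj: "feature_spectrum P (\<lambda>x. proj_upto m u (\<Phi> x)) G \<nu> f"
    and i: "i < m" "0 < \<mu> i"
    and \<tau>: "(\<Sum>j<m. (norm (e j - proj_upto m u (e j)))\<^sup>2) \<le> \<tau>"
  shows "\<mu> i - 2 * G\<^sup>2 * \<tau> \<le> \<nu> i"
proof -
  let ?Q = "proj_upto m u"
  interpret Q: feature_spectrum P "\<lambda>x. ?Q (\<Phi> x)" G \<nu> f by (rule proj)
  have \<tau>0: "0 \<le> \<tau>" by (rule order_trans[OF _ \<tau>]) (simp add: sum_nonneg)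
  \<comment> \<open>The families exchange roles: \<open>h\<close> is spanned by the leading
    \<open>e\<close> and orthogonal to the leading \<open>f\<close>.\<close>
  obtain c h where h: "h = (\<Sum>j\<le>i. c j *\<^sub>R e j)" "norm h = 1" "\<And>j. j < i \<Longrightarrow> h \<bullet> f j = 0"
    using eigenspan_meets_orthogonal[OF i(2), of f] by blast
  have pos: "0 < \<mu> j" if "j \<le> i" for j
    using eigenvalue_antimono[OF that] i(2) by simp
  have "(norm h)\<^sup>2 = (\<Sum>j\<le>i. (c j)\<^sup>2)"
    unfolding h(1) using pos
    by (subst norm_sum_scaleR_orthogonal) (auto simp: eigenvector_orth power2_norm_eq_inner)
  then have c: "(\<Sum>j\<le>i. (c j)\<^sup>2) = 1" using h(2) by simp
  define r where "r = h - ?Q h"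
  \<comment> \<open>This is \<Sigma> h. The factor \<open>G\<^sup>2\<close> of the loss comes from
    the bound on the eigenvalues in its coefficients.\<close>
  define w where "w = (\<Sum>j\<le>i. (c j * \<mu> j) *\<^sub>R e j)"
  have sub: "{..i} \<subseteq> {..<m}" using i(1) by auto
  have "(norm r)\<^sup>2 \<le> \<tau>"
    using norm_residual_combination[OF sub \<tau> h(1)] by (simp add: r_def c)
  then have nr: "norm r \<le> sqrt \<tau>" using real_le_rsqrt by blast
  have "(norm (w - ?Q w))\<^sup>2 \<le> \<tau> * (\<Sum>j\<le>i. (c j * \<mu> j)\<^sup>2)"
    by (rule norm_residual_combination[OF sub \<tau> w_def])
  also have "\<dots> \<le> \<tau> * (\<Sum>j\<le>i. (c j)\<^sup>2 * (G\<^sup>2)\<^sup>2)"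
    unfolding power_mult_distrib
    by (intro mult_left_mono sum_mono \<tau>0 power_mono eigenvalue_le eigenvalue_nonneg) auto
  also have "\<dots> = (G\<^sup>2 * sqrt \<tau>)\<^sup>2"
    using \<tau>0 by (simp add: c sum_distrib_right[symmetric] power_mult_distrib)
  finally have nw: "norm (w - ?Q w) \<le> G\<^sup>2 * sqrt \<tau>"
    by (rule power2_le_imp_le) (simp add: \<tau>0)
  have "r \<bullet> ?Q w = 0" unfolding r_def by (rule proj_upto_residual_orth[OF u])
  then have "r \<bullet> w = r \<bullet> (w - ?Q w)" by (simp add: inner_diff_right)
  also have "\<dots> \<le> norm r * norm (w - ?Q w)" by (rule norm_cauchy_schwarz)
  also have "\<dots> \<le> sqrt \<tau> * (G\<^sup>2 * sqrt \<tau>)"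
    using nr nw \<tau>0 by (intro mult_mono) auto
  also have "\<dots> = G\<^sup>2 * \<tau>" using \<tau>0 by simp
  finally have rw: "r \<bullet> w \<le> G\<^sup>2 * \<tau>" .
  have "(LINT x|P. (\<Phi> x \<bullet> r) * (\<Phi> x \<bullet> h)) = (LINT x|P. (\<Sum>j\<le>i. c j * ((\<Phi> x \<bullet> r) * (\<Phi> x \<bullet> e j))))"
    by (simp add: h(1) inner_sum_right sum_distrib_left mult_ac)
  also have "\<dots> = (\<Sum>j\<le>i. c j * (\<mu> j * (r \<bullet> e j)))"
    by (subst Bochner_Integration.integral_sum) (auto intro!: integrable_feature_prod simp: covariance)
  also have "\<dots> = r \<bullet> w" by (simp add: w_def inner_sum_right mult_ac)
  finally have cross: "(LINT x|P. (\<Phi> x \<bullet> r) * (\<Phi> x \<bullet> h)) = r \<bullet> w" .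
  \<comment> \<open>With a and b the inner products of \<Phi> x with \<open>h\<close> and
    \<open>r\<close>, the projected form is the mean of (a - b)^2 >= a^2 - 2 a b.\<close>
  have "\<mu> i - 2 * (r \<bullet> w) \<le> (LINT x|P. (\<Phi> x \<bullet> h)\<^sup>2) - 2 * (LINT x|P. (\<Phi> x \<bullet> r) * (\<Phi> x \<bullet> h))"
    using variance_ge_on_span[OF i(2) h(1)] h(2) by (simp add: cross)
  also have "\<dots> = (LINT x|P. (\<Phi> x \<bullet> h)\<^sup>2 - 2 * ((\<Phi> x \<bullet> r) * (\<Phi> x \<bullet> h)))"
    by (simp add: integrable_feature_sq integrable_feature_prod)
  also have "\<dots> \<le> (LINT x|P. (?Q (\<Phi> x) \<bullet> h)\<^sup>2)"
  proof (rule integral_mono)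
    fix x
    have "?Q (\<Phi> x) \<bullet> h = \<Phi> x \<bullet> h - \<Phi> x \<bullet> r"
      by (simp add: proj_upto_symmetric r_def inner_diff_right)
    then have "(?Q (\<Phi> x) \<bullet> h)\<^sup>2 = (\<Phi> x \<bullet> h)\<^sup>2 - 2 * ((\<Phi> x \<bullet> r) * (\<Phi> x \<bullet> h)) + (\<Phi> x \<bullet> r)\<^sup>2"
      by (simp add: power2_diff mult_ac)
    then show "(\<Phi> x \<bullet> h)\<^sup>2 - 2 * ((\<Phi> x \<bullet> r) * (\<Phi> x \<bullet> h)) \<le> (?Q (\<Phi> x) \<bullet> h)\<^sup>2"
      by simp
  qed (simp_all add: integrable_feature_sq integrable_feature_prod Q.integrable_feature_sq)
  also have "\<dots> \<le> \<nu> i"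
    using Q.variance_le_of_orth[of i h] h(2,3) by simp
  finally show ?thesis using rw by (simp add: mult.assoc)
qed

end

section \<open>Support of the measure and assembly of the bounds\<close>

text \<open>Points outside the support have open null neighbourhoods, and by the Lindelof property
  countably many of these suffice.\<close>

lemma AE_in_measure_support:
  fixes P :: "'a::second_countable_topology measure"
  assumes "sets P = sets borel" "closed (measure_support P)"
  shows "AE x in P. x \<in> measure_support P"
proof -
  have sp: "space P = UNIV" using sets_eq_imp_space_eq[OF assms(1)] by simp
  define F where "F = {U. open U \<and> emeasure P U = 0}"
  obtain F' where F': "F' \<subseteq> F" "countable F'" "\<Union>F' = \<Union>F"
    using Lindelof[of F] by (auto simp: F_def)
  have "(\<Union>U\<in>F'. U) \<in> null_sets P"
  proof (rule null_sets_UN')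
    show "U \<in> null_sets P" if "U \<in> F'" for U
      using that F'(1) assms(1) by (auto simp: F_def null_sets_def)
  qed (rule F'(2))
  moreover have "{x \<in> space P. x \<notin> measure_support P} \<subseteq> (\<Union>U\<in>F'. U)"
    using F'(3) by (auto simp: measure_support_def F_def not_gr_zero)
  ultimately show ?thesis by (intro AE_I') auto
qed

theorem theorem2:
  fixes A :: "'a::euclidean_space set"
    and P :: "'a measure"
    and K :: "'a \<Rightarrow> 'a \<Rightarrow> real"
    and \<Phi> :: "'a \<Rightarrow> 'h::{real_inner, complete_space}"
    and \<mu> :: "nat \<Rightarrow> real" and \<phi> :: "nat \<Rightarrow> 'a \<Rightarrow> real"
    and G B \<epsilon> \<alpha> :: real and m p :: nat
  assumes A_compact: "compact A"
    and P_prob: "prob_space P" and P_borel: "sets P = sets borel"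
    and P_supp: "measure_support P = A"
    and K_cont: "continuous_on (A \<times> A) (\<lambda>(x, y). K x y)"
    and K_sq_int: "integrable (P \<Otimes>\<^sub>M P) (\<lambda>(x, y). (K x y)\<^sup>2)"
    and K_pd: "pos_def_kernel A K"
    and feature: "\<forall>x\<in>A. \<forall>y\<in>A. K x y = \<Phi> x \<bullet> \<Phi> y"
    and RKHS: "closure (span (\<Phi> ` A)) = UNIV"
    and G_bound: "\<forall>a\<in>A. K a a \<le> G\<^sup>2"
    and mercer: "mercer_system P A K \<mu> \<phi>"
    and B_bound: "\<forall>j. \<forall>x\<in>A. \<bar>\<phi> j x\<bar> \<le> B"
    and eps: "\<epsilon> > 0"
    and m_pos: "m \<ge> 1"
    and tail: "(\<Sum>j. \<mu> (j + m)) \<le> \<epsilon> / (4 * B\<^sup>2)"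
    and gap: "\<mu> (m - 1) > \<mu> m"
    and alpha: "\<alpha> > 0"
    and p_large: "let \<delta> = (\<mu> (m - 1) - \<mu> m) / 2;
                      Bm = 2 * G\<^sup>2 / \<delta> * (1 + sqrt (\<alpha> / 2))
                  in real p \<ge> 4 * Bm\<^sup>2 * G\<^sup>2 / (min (sqrt \<epsilon>) \<delta>)\<^sup>2"
  shows "\<exists>E \<in> sets (PiM {..<p} (\<lambda>_. P)).
           E \<subseteq> {xs \<in> space (PiM {..<p} (\<lambda>_. P)).
                  \<forall>S. top_eigenspace (sample_cov \<Phi> p xs) m S \<longrightarrow>
                    (\<forall>x\<in>A. \<forall>y\<in>A. \<bar>K x y - proxy_kernel \<Phi> S x y\<bar> \<le> \<epsilon>) \<and>
                    (\<forall>\<nu> \<psi>. mercer_system P A (proxy_kernel \<Phi> S) \<nu> \<psi> \<longrightarrow>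
                       (\<forall>i<m. \<bar>\<nu> i - \<mu> i\<bar> \<le> \<epsilon> / 4))} \<and>
           measure (PiM {..<p} (\<lambda>_. P)) E \<ge> 1 - exp (- \<alpha>)"
proof -
  interpret P: prob_space P by (rule P_prob)
  have A_closed: "closed A" using A_compact by (rule compact_imp_closed)
  then have A_sets [measurable]: "A \<in> sets P" using P_borel by auto
  have AE_A: "AE x in P. x \<in> A"
    using AE_in_measure_support[OF P_borel] A_closed by (simp add: P_supp)
  \<comment> \<open>Nothing is assumed about \<Phi> outside \<open>A\<close>; cutting it off there
    makes it bounded and measurable everywhere and changes it only on a null set.\<close>
  define F where "F x = (if x \<in> A then \<Phi> x else 0)" for x
  have F: "F x = \<Phi> x" if "x \<in> A" for x using that by (simp add: F_def)
  \<comment> \<open>Continuity of \<open>K\<close> passes to \<Phi> because the squared distance of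
    features is \<open>K y y - 2 * K x y + K x x\<close>. It gives the measurability of
    \<open>F\<close>.\<close>
  have \<Phi>_cont: "continuous_on A \<Phi>"
    unfolding continuous_on_def
  proof
    fix x assume x: "x \<in> A"
    have Kc: "((\<lambda>y. K (f y) (g y)) \<longlongrightarrow> K x x) (at x within A)"
      if "continuous_on A f" "continuous_on A g" "f ` A \<subseteq> A" "g ` A \<subseteq> A" "f x = x" "g x = x" for f g
    proof -
      have "continuous_on A ((\<lambda>(x, y). K x y) \<circ> (\<lambda>y. (f y, g y)))"
        using that by (intro continuous_on_compose continuous_on_Pair continuous_on_subset[OF K_cont]) auto
      from this[unfolded continuous_on_def, rule_format, OF x] show ?thesis
        using that(5,6) by (simp add: o_def)
    qed
    have "((\<lambda>y. K y y - 2 * K x y + K x x) \<longlongrightarrow> K x x - 2 * K x x + K x x) (at x within A)"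
      using x by (intro tendsto_intros Kc) (auto intro!: continuous_intros)
    moreover have "\<forall>\<^sub>F y in at x within A. K y y - 2 * K x y + K x x = (norm (\<Phi> y - \<Phi> x))\<^sup>2"
      using x feature
      by (auto simp: eventually_at_filter power2_norm_eq_inner inner_diff inner_commute intro!: always_eventually)
    ultimately have "((\<lambda>y. (norm (\<Phi> y - \<Phi> x))\<^sup>2) \<longlongrightarrow> 0) (at x within A)"
      by (simp add: tendsto_cong)
    from tendsto_real_sqrt[OF this] have "((\<lambda>y. \<Phi> y - \<Phi> x) \<longlongrightarrow> 0) (at x within A)"
      by (simp add: tendsto_norm_zero_iff)
    then show "(\<Phi> \<longlongrightarrow> \<Phi> x) (at x within A)" by (rule LIM_zero_cancel)
  qed
  \<comment> \<open>The sign of \<open>G\<close> is not fixed, while a norm bound must be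
    nonnegative.\<close>
  define R where "R = \<bar>G\<bar>"
  have bfm: "bounded_feature_map P F R"
  proof unfold_locales
    show "(\<lambda>x. F x \<bullet> h) \<in> borel_measurable P" for h
    proof -
      have "(\<lambda>x. indicator A x *\<^sub>R (\<Phi> x \<bullet> h)) \<in> borel_measurable borel"
        using A_closed \<Phi>_cont
        by (intro borel_measurable_continuous_on_indicator continuous_on_inner continuous_on_const) auto
      moreover have "(\<lambda>x. indicator A x *\<^sub>R (\<Phi> x \<bullet> h)) = (\<lambda>x. F x \<bullet> h)"
        by (auto simp: F_def)
      ultimately show ?thesis using measurable_cong_sets[OF P_borel refl] by metis
    qed
    show "norm (F x) \<le> R" for x
      using G_bound feature real_sqrt_le_mono[of "\<Phi> x \<bullet> \<Phi> x" "G\<^sup>2"]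
      by (auto simp: F_def R_def norm_eq_sqrt_inner)
  qed
  obtain e where spec: "feature_spectrum P F R \<mu> e"
    and ev: "\<And>j x. x \<in> A \<Longrightarrow> F x \<bullet> e j = sqrt (\<mu> j) * \<phi> j x"
    by (rule mercer_feature_spectrum[OF bfm AE_A _ _ mercer]) (auto simp: F_def feature)
  interpret feature_spectrum P F R \<mu> e by (rule spec)
  have \<mu>pos: "0 < \<mu> i" if "i < m" for i
    using eigenvalue_antimono[of i "m - 1"] eigenvalue_nonneg[of m] gap that by fastforce
  have R0: "R > 0"
    using \<mu>pos[of 0] m_pos eigenvalue_le[of 0] by (auto simp: R_def)
  define \<delta> where "\<delta> = (\<mu> (m - 1) - \<mu> m) / 2"
  define t where "t = 2 * R\<^sup>2 / sqrt p * (1 + sqrt (\<alpha> / 2))"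
  define s where "s = 1 + sqrt (\<alpha> / 2)"
  have s: "s > 0" using alpha by (simp add: s_def add_pos_nonneg)
  have \<delta>: "\<delta> > 0" using gap by (simp add: \<delta>_def)
  \<comment> \<open>The numerator 4 B_m^2 G^2 of the sample size condition.\<close>
  define c where "c = 4 * (2 * R\<^sup>2 / \<delta> * s)\<^sup>2 * R\<^sup>2"
  have c: "c > 0" using R0 \<delta> s by (simp add: c_def)
  have "min (sqrt \<epsilon>) \<delta> > 0" using eps \<delta> by simp
  then have "0 < (min (sqrt \<epsilon>) \<delta>)\<^sup>2" "(min (sqrt \<epsilon>) \<delta>)\<^sup>2 \<le> (sqrt \<epsilon>)\<^sup>2"
    by (simp_all only: zero_less_power) (intro power_mono, simp_all)
  then have "c / \<epsilon> \<le> c / (min (sqrt \<epsilon>) \<delta>)\<^sup>2"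
    using c eps by (intro divide_left_mono) auto
  also have "\<dots> \<le> p"
    using p_large unfolding Let_def \<delta>_def[symmetric] s_def[symmetric] by (simp add: c_def R_def)
  finally have pc: "c / \<epsilon> \<le> p" .
  then have p0: "p > 0" using c eps by (metis divide_pos_pos less_le_trans of_nat_0_less_iff)
  \<comment> \<open>The bound of \<open>eigenspace_deviation\<close> for the gap
    \<open>2 * \<delta>\<close>; the constants combine to
    \<open>R\<^sup>2 * \<tau> = c / (8 * p)\<close>.\<close>
  define \<tau> where "\<tau> = 2 * (t / (2 * \<delta>))\<^sup>2"
  have "R\<^sup>2 * \<tau> = c / p / 8"
    using p0 by (simp add: \<tau>_def t_def s_def c_def power_divide power_mult_distrib)
  also have "\<dots> \<le> \<epsilon> / 8" using pc p0 eps by (simp add: field_simps)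
  finally have \<tau>: "R\<^sup>2 * \<tau> \<le> \<epsilon> / 8" .
  let ?M = "PiM {..<p} (\<lambda>_. P)"
  interpret M: prob_space ?M by (rule prob_space_PiM) (rule P_prob)
  define E0 where "E0 = {xs \<in> space ?M. \<forall>N. L2_set (dev p xs) ({..<N} \<times> {..<N}) \<le> t}"
  \<comment> \<open>On samples from \<open>A\<close> the covariances of \<Phi> and of
    \<open>F\<close> coincide; the restriction costs no probability.\<close>
  define E where "E = {xs \<in> E0. \<forall>i\<in>{..<p}. xs i \<in> A}"
  have E0: "E0 \<in> sets ?M" "1 - exp (- \<alpha>) \<le> measure ?M E0"
    using covariance_concentration[OF R0 p0 alpha] by (simp_all add: E0_def t_def)
  have "{xs \<in> space ?M. \<forall>i\<in>{..<p}. xs i \<in> A} \<in> sets ?M" by measurable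
  moreover have "E = E0 \<inter> {xs \<in> space ?M. \<forall>i\<in>{..<p}. xs i \<in> A}"
    by (auto simp: E_def E0_def)
  ultimately have E_sets: "E \<in> sets ?M" using E0(1) by simp
  have "AE xs in ?M. \<forall>i\<in>{..<p}. xs i \<in> A"
    by (intro AE_ball_countable[THEN iffD2] ballI AE_PiM_component P_prob AE_A) auto
  then have "measure ?M E = measure ?M E0"
    using E_sets E0(1) by (intro measure_eq_AE) (auto simp: E_def)
  then have E_prob: "measure ?M E \<ge> 1 - exp (- \<alpha>)" using E0(2) by simp
  have summ: "summable (\<lambda>j. \<mu> (j + m))"
    using summable_eigenvalues by (simp add: summable_iff_shift)
  have trunc_le: "(norm (F x - trunc m x))\<^sup>2 \<le> \<epsilon> / 4" if x: "x \<in> A" for x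
  proof -
    have sums: "(\<lambda>j. (F x \<bullet> e (j + m))\<^sup>2) sums (norm (F x - trunc m x))\<^sup>2"
      unfolding norm_trunc_residual by (rule sums_split_initial_segment[OF complete])
    have "(norm (F x - trunc m x))\<^sup>2 \<le> (\<Sum>j. \<mu> (j + m) * B\<^sup>2)"
      unfolding sums_unique[OF sums]
    proof (rule suminf_le)
      fix j
      have "(\<phi> (j + m) x)\<^sup>2 \<le> B\<^sup>2"
        using B_bound x power_mono[of "\<bar>\<phi> (j + m) x\<bar>" B 2] by simp
      then show "(F x \<bullet> e (j + m))\<^sup>2 \<le> \<mu> (j + m) * B\<^sup>2"
        by (simp add: ev[OF x] power_mult_distrib eigenvalue_nonneg mult_left_mono)
    qed (use sums summ in \<open>auto simp: sums_iff intro: summable_mult2\<close>)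
    also have "\<dots> = (\<Sum>j. \<mu> (j + m)) * B\<^sup>2" by (rule suminf_mult2[OF summ, symmetric])
    also have "\<dots> \<le> \<epsilon> / (4 * B\<^sup>2) * B\<^sup>2" by (intro mult_right_mono tail) simp
    \<comment> \<open>For \<open>B = 0\<close> the quotient is 0 by convention and the bound still
      holds.\<close>
    also have "\<dots> \<le> \<epsilon> / 4" using eps by (cases "B = 0") auto
    finally show ?thesis .
  qed
  have main: "(\<forall>x\<in>A. \<forall>y\<in>A. \<bar>K x y - proxy_kernel \<Phi> S x y\<bar> \<le> \<epsilon>) \<and>
      (\<forall>\<nu> \<psi>. mercer_system P A (proxy_kernel \<Phi> S) \<nu> \<psi> \<longrightarrow> (\<forall>i<m. \<bar>\<nu> i - \<mu> i\<bar> \<le> \<epsilon> / 4))"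
    if xs: "xs \<in> E" and S: "top_eigenspace (sample_cov \<Phi> p xs) m S" for xs S
  proof -
    have xsA: "xs i \<in> A" if "i < p" for i using xs that by (simp add: E_def)
    have "sample_cov \<Phi> p xs = sample_cov F p xs"
      by (simp add: fun_eq_iff sample_cov_def F xsA)
    with S obtain u where u: "orthonormal_upto m u" and Su: "S = span (u ` {..<m})"
      and maximal: "\<And>w. orthonormal_upto m w \<Longrightarrow>
        (\<Sum>j<m. \<Sum>i<p. (F (xs i) \<bullet> w j)\<^sup>2) \<le> (\<Sum>j<m. \<Sum>i<p. (F (xs i) \<bullet> u j)\<^sup>2)"
      using top_eigenspace_trace_maximal[of F p xs m S] m_pos p0 by auto
    let ?Q = "proj_upto m u"
    have Q: "orth_proj S v = ?Q v" for v unfolding Su by (rule orth_proj_span[OF u])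
    have dev: "L2_set (dev p xs) ({..<N} \<times> {..<N}) \<le> t" for N
      using xs by (simp add: E_def E0_def)
    have \<tau>u: "(\<Sum>j<m. (norm (e j - ?Q (e j)))\<^sup>2) \<le> \<tau>"
    proof -
      have "2 * \<delta> = \<mu> (m - 1) - \<mu> m" by (simp add: \<delta>_def)
      then show ?thesis
        using eigenspace_deviation[OF u m_pos gap dev maximal[OF orthonormal_upto_eigenvectors[OF \<mu>pos]]]
        by (simp only: \<tau>_def)
    qed
    \<comment> \<open>The rotation of the eigenspace and the spectral tail each contribute at most
      \<open>sqrt (\<epsilon> / 4)\<close>, half of \<open>sqrt \<epsilon>\<close>.\<close>
    have res: "norm (F x - ?Q (F x)) \<le> sqrt \<epsilon>" if x: "x \<in> A" for x
    proof -
      have "norm (F x - trunc m x) \<le> sqrt (\<epsilon> / 4)" using trunc_le[OF x] by (rule real_le_rsqrt)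
      moreover have "R * sqrt \<tau> \<le> sqrt (\<epsilon> / 4)"
      proof -
        have "R * sqrt \<tau> = sqrt (R\<^sup>2 * \<tau>)" using R0 by (simp add: real_sqrt_mult)
        also have "\<dots> \<le> sqrt (\<epsilon> / 4)" using \<tau> eps by (intro real_sqrt_le_mono) simp
        finally show ?thesis .
      qed
      ultimately show ?thesis
        using norm_feature_residual[OF u \<tau>u, of x] by (simp add: real_sqrt_divide)
    qed
    have "\<bar>K x y - proxy_kernel \<Phi> S x y\<bar> \<le> \<epsilon>" if x: "x \<in> A" and y: "y \<in> A" for x y
    proof -
      \<comment> \<open>The kernel error is the inner product of two residuals, so it is quadratic
        in the residual norm.\<close>
      have "K x y - proxy_kernel \<Phi> S x y = (F x - ?Q (F x)) \<bullet> (F y - ?Q (F y))"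
        using proj_upto_residual_orth[OF u, of "F x" "F y"] proj_upto_residual_orth[OF u, of "F y" "F x"]
          x y feature
        by (simp add: proxy_kernel_def Q F inner_diff inner_commute)
      also have "\<bar>\<dots>\<bar> \<le> norm (F x - ?Q (F x)) * norm (F y - ?Q (F y))"
        by (rule Cauchy_Schwarz_ineq2)
      also have "\<dots> \<le> sqrt \<epsilon> * sqrt \<epsilon>"
        using res[OF x] res[OF y] eps by (intro mult_mono) auto
      finally show ?thesis using eps by simp
    qed
    moreover have "\<bar>\<nu> i - \<mu> i\<bar> \<le> \<epsilon> / 4"
      if mercer': "mercer_system P A (proxy_kernel \<Phi> S) \<nu> \<psi>" and i: "i < m" for \<nu> \<psi> i
    proof -
      \<comment> \<open>The projected features realize the proxy kernel on \<open>A\<close>, so its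
        Mercer system yields eigenvectors in the same feature space.\<close>
      have bfm': "bounded_feature_map P (\<lambda>x. ?Q (F x)) R"
        by unfold_locales
          (auto simp: proj_upto_symmetric intro: order_trans[OF norm_proj_upto_le[OF u] feature_bound])
      obtain f where proj: "feature_spectrum P (\<lambda>x. ?Q (F x)) R \<nu> f"
        by (rule mercer_feature_spectrum[OF bfm' AE_A _ _ mercer'])
          (auto simp: F_def proxy_kernel_def Q linear_0[OF linear_proj_upto])
      have "\<nu> i \<le> \<mu> i" by (rule projected_eigenvalue_le[OF u proj])
      moreover have "\<mu> i - 2 * R\<^sup>2 * \<tau> \<le> \<nu> i"
        by (rule projected_eigenvalue_ge[OF u proj i \<mu>pos[OF i] \<tau>u])
      ultimately show ?thesis using \<tau> by simp
    qed
    ultimately show ?thesis by blast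
  qed
  have "xs \<in> space ?M" if "xs \<in> E" for xs using that by (simp add: E_def E0_def)
  then show ?thesis
    by (intro bexI[OF _ E_sets] E_prob main conjI subsetI CollectI allI impI) assumption+
qed

end
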